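(* Let $m,n\in\mathbb{N}$ with $m\geq 2$ and let $A\in M_n$ be nonsingular. Then the following are equivalent: (i) $W(\mathcal{K}_m(A))$ is a circular disk centered at $0$. (ii) The boundary of $W(\mathcal{K}_m(A))$ contains an elliptic arc. (iii) $m=2$.
   Context: $M_n$ is the set of $n\times n$ complex matrices. For $A\in M_n$ and $m\ge 2$, the block upper triangular KMS matrix $\mathcal{K}_m(A)$ is the $mn\times mn$ matrix whose $(i,j)$ block ($n\times n$, $1\le i,j\le m$) is $A^{j-i}$ if $j>i$ and $0$ if $j\le i$. The numerical range of $X\in M_N$ is $W(X)=\{x^*Xx: x\in\mathbb{C}^N,\ \|x\|=1\}\subset\mathbb{C}$. An elliptic arc is a (nontrivial) arc of the boundary curve of a (non-degenerate) elliptic disk in $\mathbb{C}\cong\mathbb{R}^2$; circles are included among ellipses. *)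

theory Defs
  imports "HOL-Analysis.Analysis" "Jordan_Normal_Form.Matrix"
begin

no_notation inner (infix "\<bullet>" 70)

(* With 0-based indices, row r of the (m * n) x (m * n) matrix lies in block row r div n,
   at row r mod n of that block; likewise for columns. *)
definition KMS_matrix :: "nat \<Rightarrow> complex mat \<Rightarrow> complex mat" where
  "KMS_matrix m A =
     (let n = dim_row A in
       mat (m * n) (m * n)
         (\<lambda>(r, c). if r div n < c div n
                   then (A ^\<^sub>m (c div n - r div n)) $$ (r mod n, c mod n)
                   else 0))"

definition euclidean_norm :: "complex vec \<Rightarrow> real" where
  "euclidean_norm x = L2_set (\<lambda>i. cmod (x $ i)) {..<dim_vec x}"

(* v \<bullet>c w conjugates its second argument, so (X *\<^sub>v x) \<bullet>c x is x* X x. *)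
definition numerical_range :: "complex mat \<Rightarrow> complex set" where
  "numerical_range X =
     {(X *\<^sub>v x) \<bullet>c x | x. x \<in> carrier_vec (dim_row X) \<and> euclidean_norm x = 1}"

(* Centre z0, semi-axes a and b, the a-axis making the angle t with the real axis. *)
definition elliptic_disk :: "complex set \<Rightarrow> bool" where
  "elliptic_disk E \<longleftrightarrow>
     (\<exists>z0 t a b. a > 0 \<and> b > 0 \<and>
        E = {z0 + cis t * Complex (a * u) (b * v) | u v. u\<^sup>2 + v\<^sup>2 \<le> 1})"

(* arc g asserts that g is continuous and injective on [0, 1],
   so path_image g is never a single point. *)
definition elliptic_arc :: "complex set \<Rightarrow> bool" where
  "elliptic_arc S \<longleftrightarrow>
     (\<exists>E g. elliptic_disk E \<and> arc g \<and> path_image g \<subseteq> frontier E \<and> S = path_image g)"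

end

(*
  If the boundary of W(K) contains an elliptic arc, then for z = e^(i phi) in an infinite set the
  matrix c(z) I - beta(z) K - gamma(z) K^* (with quadratic polynomials c, beta, gamma given by the
  supporting lines of the ellipse) is singular, hence singular for every complex z.
  Since K is nilpotent, choosing z with gamma(z) = 0 forces the ellipse to be a circle of some
  radius r centred at 0.  Choosing z = -2 r e^(-i t) then shows that 2 r is a singular value of A,
  say A v = 2 r w with |v| = |w|.  If m >= 3, placing w and e^(i theta) v in the second and third
  blocks gives a vector at which the form of K takes the boundary value r e^(i theta); the first
  block of the resulting kernel equation reads (1 + 2 r e^(i theta)) A w = 0, which is impossible
  for nonsingular A and all but one of the admissible angles.
  For m = 2 the numerical range is compact, convex and invariant under rotation.
*)
theory Submission
  imports Defs "Jordan_Normal_Form.Determinant"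
begin

section \<open>Numerical ranges\<close>

no_notation Finite_Cartesian_Product.vec_nth (infixl "$" 90)

text \<open>Write ^H for the conjugate transpose and B for the block shift with A on the
  superdiagonal, so that I + K is the inverse of I - B. Once the ellipse is a circle, the pencil in
  zeta = z e^(i t) is, up to a nonzero factor, K + zeta^2 K^H - 2 r zeta I. Multiplied by I - B^H on
  the left and I - B on the right it becomes -2 r zeta I + (1 + 2 r zeta) B + zeta (zeta + 2 r) B^H
  - (1 + 2 r zeta + zeta^2) B^H B. The value zeta = -2 r is the nonzero one that removes the B^H
  term: a block upper triangular matrix remains, with diagonal blocks 4 r^2 I and 4 r^2 I - A^H A,
  so its singularity makes 2 r a singular value of A. This is carried out below block by block. The
  test vector for m >= 3 starts in the second block because the first block of its kernel equation
  is then free of the vector itself and of the K^H term; only K contributes there. With m = 2 there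
  is no room for such an empty block.\<close>

definition conj_transpose :: "complex mat \<Rightarrow> complex mat" where
  "conj_transpose A = map_mat cnj (transpose_mat A)"

lemma conj_transpose_carrier [simp]:
  "A \<in> carrier_mat m n \<Longrightarrow> conj_transpose A \<in> carrier_mat n m"
  by (simp add: conj_transpose_def)

lemma cscalar_prod_sum:
  fixes x y :: "complex vec"
  assumes "y \<in> carrier_vec n"
  shows "x \<bullet>c y = (\<Sum>i<n. x $ i * cnj (y $ i))"
  using assms by (auto simp: scalar_prod_def lessThan_atLeast0 intro!: sum.cong)

lemma cscalar_prod_commute:
  fixes x y :: "complex vec"
  assumes "x \<in> carrier_vec n" "y \<in> carrier_vec n"
  shows "y \<bullet>c x = cnj (x \<bullet>c y)"
  using assms by (simp add: cscalar_prod_sum[of _ n] mult.commute)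

lemma mult_mat_vec_sum:
  assumes "A \<in> carrier_mat m n" "x \<in> carrier_vec n" "i < m"
  shows "(A *\<^sub>v x) $ i = (\<Sum>j<n. A $$ (i, j) * x $ j)"
  using assms by (auto simp: scalar_prod_def lessThan_atLeast0 intro!: sum.cong)

lemma cscalar_prod_conj_transpose:
  fixes A :: "complex mat"
  assumes A: "A \<in> carrier_mat m n" and x: "x \<in> carrier_vec n" and y: "y \<in> carrier_vec m"
  shows "(A *\<^sub>v x) \<bullet>c y = x \<bullet>c (conj_transpose A *\<^sub>v y)"
proof -
  have H: "conj_transpose A \<in> carrier_mat n m" using A by simp
  have "(A *\<^sub>v x) \<bullet>c y = (\<Sum>i<m. (\<Sum>j<n. A $$ (i, j) * x $ j) * cnj (y $ i))"
    unfolding cscalar_prod_sum[OF y] by (intro sum.cong refl) (simp add: mult_mat_vec_sum[OF A x])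
  also have "\<dots> = (\<Sum>j<n. \<Sum>i<m. A $$ (i, j) * x $ j * cnj (y $ i))"
    unfolding sum_distrib_right by (rule sum.swap)
  also have "\<dots> = (\<Sum>j<n. x $ j * cnj ((conj_transpose A *\<^sub>v y) $ j))"
  proof (intro sum.cong refl)
    fix j assume "j \<in> {..<n}"
    then have "(conj_transpose A *\<^sub>v y) $ j = (\<Sum>i<m. cnj (A $$ (i, j)) * y $ i)"
      using A by (subst mult_mat_vec_sum[OF H y]) (auto simp: conj_transpose_def)
    then show "(\<Sum>i<m. A $$ (i, j) * x $ j * cnj (y $ i)) = x $ j * cnj ((conj_transpose A *\<^sub>v y) $ j)"
      by (simp add: sum_distrib_left mult_ac)
  qed
  also have "\<dots> = x \<bullet>c (conj_transpose A *\<^sub>v y)"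
    by (rule cscalar_prod_sum[symmetric]) (use H y in simp)
  finally show ?thesis .
qed

lemma cscalar_prod_self:
  "x \<bullet>c x = of_real ((euclidean_norm x)\<^sup>2)"
  by (subst cscalar_prod_sum[of _ "dim_vec x"])
     (auto simp: euclidean_norm_def L2_set_def sum_nonneg complex_norm_square simp flip: of_real_power)

lemma euclidean_norm_eq_1_iff: "euclidean_norm x = 1 \<longleftrightarrow> x \<bullet>c x = 1"
proof -
  have "0 \<le> euclidean_norm x" by (simp add: euclidean_norm_def)
  then show ?thesis
    unfolding cscalar_prod_self by (metis of_real_eq_1_iff one_power2 power2_eq_1_iff neg_0_le_iff_le not_one_le_zero)
qed

lemma cscalar_prod_self_pos:
  fixes x :: "complex vec"
  assumes "x \<in> carrier_vec n" "x \<noteq> 0\<^sub>v n"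
  shows "Re (x \<bullet>c x) > 0" "x \<bullet>c x = of_real (Re (x \<bullet>c x))"
proof -
  show *: "x \<bullet>c x = of_real (Re (x \<bullet>c x))" by (simp add: cscalar_prod_self)
  have "x \<bullet>c x \<noteq> 0" using assms conjugate_square_eq_0_vec[of x n] by simp
  then have "Re (x \<bullet>c x) \<noteq> 0" using * by (metis of_real_0)
  then show "Re (x \<bullet>c x) > 0" by (simp add: cscalar_prod_self)
qed

lemma numerical_range_iff:
  assumes "X \<in> carrier_mat N N"
  shows "z \<in> numerical_range X \<longleftrightarrow> (\<exists>x\<in>carrier_vec N. x \<bullet>c x = 1 \<and> z = (X *\<^sub>v x) \<bullet>c x)"
  using assms by (auto simp: numerical_range_def euclidean_norm_eq_1_iff)

lemma mult_mat_vec_add_smult: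
  fixes X :: "complex mat"
  assumes "X \<in> carrier_mat N N" "x \<in> carrier_vec N" "y \<in> carrier_vec N"
  shows "X *\<^sub>v (a \<cdot>\<^sub>v x + b \<cdot>\<^sub>v y) = a \<cdot>\<^sub>v (X *\<^sub>v x) + b \<cdot>\<^sub>v (X *\<^sub>v y)"
  using assms by (simp add: mult_add_distrib_mat_vec[of _ N N] mult_mat_vec)

lemma mult_mat_zero_vec [simp]:
  fixes A :: "'a :: semiring_0 mat"
  shows "A \<in> carrier_mat m n \<Longrightarrow> A *\<^sub>v 0\<^sub>v n = 0\<^sub>v m"
  by (intro eq_vecI) auto

lemma smult_vec_zero [simp]: "k \<cdot>\<^sub>v 0\<^sub>v n = (0\<^sub>v n :: 'a :: mult_zero vec)"
  by (intro eq_vecI) auto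

lemma smult_mat_mult_mat_vec:
  fixes A :: "'a :: comm_semiring_0 mat"
  assumes "A \<in> carrier_mat m n" "x \<in> carrier_vec n"
  shows "(k \<cdot>\<^sub>m A) *\<^sub>v x = k \<cdot>\<^sub>v (A *\<^sub>v x)"
  using assms by (intro eq_vecI) auto

lemma cscalar_prod_add_smult_left:
  fixes x :: "complex vec"
  assumes "x \<in> carrier_vec N" "y \<in> carrier_vec N" "z \<in> carrier_vec N"
  shows "(a \<cdot>\<^sub>v x + b \<cdot>\<^sub>v y) \<bullet>c z = a * (x \<bullet>c z) + b * (y \<bullet>c z)"
  using assms by (simp add: cscalar_prod_sum[of _ N] sum_distrib_left sum.distrib[symmetric] algebra_simps)

lemma cscalar_prod_add_smult_right:
  fixes x :: "complex vec"
  assumes "x \<in> carrier_vec N" "y \<in> carrier_vec N" "z \<in> carrier_vec N"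
  shows "z \<bullet>c (a \<cdot>\<^sub>v x + b \<cdot>\<^sub>v y) = cnj a * (z \<bullet>c x) + cnj b * (z \<bullet>c y)"
  using assms by (simp add: cscalar_prod_sum[of _ N] sum_distrib_left sum.distrib[symmetric] algebra_simps)

lemma quadratic_form_add_smult:
  fixes X :: "complex mat"
  assumes X: "X \<in> carrier_mat N N" and x: "x \<in> carrier_vec N" and y: "y \<in> carrier_vec N"
  shows "(X *\<^sub>v (a \<cdot>\<^sub>v x + b \<cdot>\<^sub>v y)) \<bullet>c (a \<cdot>\<^sub>v x + b \<cdot>\<^sub>v y) =
    a * cnj a * ((X *\<^sub>v x) \<bullet>c x) + a * cnj b * ((X *\<^sub>v x) \<bullet>c y)
      + b * cnj a * ((X *\<^sub>v y) \<bullet>c x) + b * cnj b * ((X *\<^sub>v y) \<bullet>c y)"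
proof -
  have c: "X *\<^sub>v x \<in> carrier_vec N" "X *\<^sub>v y \<in> carrier_vec N" "a \<cdot>\<^sub>v x + b \<cdot>\<^sub>v y \<in> carrier_vec N"
    using X x y by simp_all
  show ?thesis
    unfolding mult_mat_vec_add_smult[OF X x y] cscalar_prod_add_smult_left[OF c]
      cscalar_prod_add_smult_right[OF x y c(1)] cscalar_prod_add_smult_right[OF x y c(2)]
    by (simp add: algebra_simps)
qed

section \<open>Convexity and compactness of the numerical range\<close>

lemma numerical_range_normalize:
  assumes X: "X \<in> carrier_mat N N" and x: "x \<in> carrier_vec N" "x \<noteq> 0\<^sub>v N"
  shows "((X *\<^sub>v x) \<bullet>c x) / (x \<bullet>c x) \<in> numerical_range X"
proof -
  define q where "q = Re (x \<bullet>c x)"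
  have q: "q > 0" "x \<bullet>c x = of_real q" using cscalar_prod_self_pos[OF x] by (simp_all add: q_def)
  define c where "c = complex_of_real (1 / sqrt q)"
  have c: "c * cnj c = 1 / of_real q"
    using q(1) by (simp add: c_def flip: of_real_mult)
  have Xx: "X *\<^sub>v x \<in> carrier_vec N" using X x by simp
  have 1: "(c \<cdot>\<^sub>v x) \<bullet>c (c \<cdot>\<^sub>v x) = c * cnj c * (x \<bullet>c x)"
    using x by (simp add: cscalar_prod_sum[of _ N] sum_distrib_left mult_ac)
  have 2: "(X *\<^sub>v (c \<cdot>\<^sub>v x)) \<bullet>c (c \<cdot>\<^sub>v x) = c * cnj c * ((X *\<^sub>v x) \<bullet>c x)"
    using x Xx X by (simp add: mult_mat_vec[OF X] cscalar_prod_sum[of _ N] sum_distrib_left mult_ac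
      del: index_mult_mat_vec)
  show ?thesis
    unfolding numerical_range_iff[OF X]
    using 1 2 q x by (intro bexI[of _ "c \<cdot>\<^sub>v x"]) (simp_all add: c)
qed


text \<open>\<open>c * p + cnj c * q\<close> differs from \<open>c * (p - cnj q)\<close> by a number
  plus its conjugate, so it suffices to rotate \<open>p - cnj q\<close> onto the positive real
  axis.\<close>

lemma exists_unimodular_cross_real:
  fixes p q :: complex
  shows "\<exists>c. c * cnj c = 1 \<and> c * p + cnj c * q \<in> \<real>"
proof (cases "p = cnj q")
  case True
  then show ?thesis by (intro exI[of _ 1]) (simp add: complex_is_Real_iff)
next
  case False
  define d where "d = p - cnj q"
  define c where "c = cnj d / of_real (cmod d)"
  have d: "cmod d \<noteq> 0" using False by (simp add: d_def)
  have "c * cnj c = cnj d * d / (of_real (cmod d) * of_real (cmod d))"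
    by (simp add: c_def)
  also have "cnj d * d = of_real (cmod d) * of_real (cmod d)"
    by (simp add: complex_norm_square[symmetric] mult.commute flip: power2_eq_square of_real_power)
  finally have 1: "c * cnj c = 1" using d by simp
  have "c * p + cnj c * q = c * d + (c * cnj q + cnj (c * cnj q))"
    by (simp add: d_def algebra_simps)
  moreover have "c * d = of_real (cmod d)"
    using d by (simp add: c_def field_simps complex_norm_square[symmetric] flip: power2_eq_square of_real_power)
  moreover have "c * cnj q + cnj (c * cnj q) \<in> \<real>" by (simp add: complex_is_Real_iff)
  ultimately show ?thesis using 1 by (metis Reals_add Reals_of_real)
qed

text \<open>The phase of \<open>x\<close> is chosen so that, after an affine normalisation of the two values
  to \<open>0\<close> and \<open>1\<close>, the quotient along the segment from \<open>x\<close> to \<open>y\<close> stays real.\<close>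

theorem convex_numerical_range:
  assumes X: "X \<in> carrier_mat N N"
  shows "convex (numerical_range X)"
proof (rule convexI)
  fix p q :: complex and u v :: real
  assume p: "p \<in> numerical_range X" and q: "q \<in> numerical_range X"
    and uv: "0 \<le> u" "0 \<le> v" "u + v = 1"
  show "u *\<^sub>R p + v *\<^sub>R q \<in> numerical_range X"
  proof (cases "p = q")
    case True
    then show ?thesis using p uv by (simp add: scaleR_left_distrib[symmetric])
  next
    case False
    obtain x where x: "x \<in> carrier_vec N" "x \<bullet>c x = 1" "p = (X *\<^sub>v x) \<bullet>c x"
      using p numerical_range_iff[OF X] by blast
    obtain y where y: "y \<in> carrier_vec N" "y \<bullet>c y = 1" "q = (X *\<^sub>v y) \<bullet>c y"
      using q numerical_range_iff[OF X] by blast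
    define g where "g = x \<bullet>c y"
    have yx: "y \<bullet>c x = cnj g" using cscalar_prod_commute[OF x(1) y(1)] by (simp add: g_def)
    \<comment> \<open>\<open>s\<close> and \<open>t\<close> are the cross terms of (X - p I) / (q -
      p), whose form takes the value 0 at \<open>x\<close> and 1 at \<open>y\<close>.\<close>
    define s where "s = ((X *\<^sub>v x) \<bullet>c y - p * g) / (q - p)"
    define t where "t = ((X *\<^sub>v y) \<bullet>c x - p * cnj g) / (q - p)"
    obtain c where c: "c * cnj c = 1" "c * s + cnj c * t \<in> \<real>"
      using exists_unimodular_cross_real by blast
    define w where "w \<tau> = (of_real (1 - \<tau>) * c) \<cdot>\<^sub>v x + of_real \<tau> \<cdot>\<^sub>v y" for \<tau> :: real
    define R where "R = Re (c * s + cnj c * t)"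
    define G where "G = Re (c * g)"
    define num where "num \<tau> = \<tau>\<^sup>2 + \<tau> * (1 - \<tau>) * R" for \<tau>
    define den where "den \<tau> = (1 - \<tau>)\<^sup>2 + 2 * \<tau> * (1 - \<tau>) * G + \<tau>\<^sup>2" for \<tau>
    have wc: "w \<tau> \<in> carrier_vec N" for \<tau> using x y by (simp add: w_def)
    have I: "(1\<^sub>m N *\<^sub>v z) = z" if "z \<in> carrier_vec N" for z :: "complex vec" using that by simp
    have den: "w \<tau> \<bullet>c w \<tau> = of_real (den \<tau>)" for \<tau>
    proof -
      have "w \<tau> \<bullet>c w \<tau> = (1\<^sub>m N *\<^sub>v w \<tau>) \<bullet>c w \<tau>" using wc by simp
      also have "\<dots> = of_real ((1-\<tau>)\<^sup>2) * (c * cnj c) + of_real (\<tau> * (1-\<tau>)) * (c * g + cnj (c * g)) + of_real (\<tau>\<^sup>2)"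
        unfolding w_def quadratic_form_add_smult[OF one_carrier_mat x(1) y(1)] I[OF x(1)] I[OF y(1)]
        by (simp add: x(2) y(2) yx flip: g_def) (simp add: algebra_simps power2_eq_square)
      also have "\<dots> = of_real (den \<tau>)"
        unfolding c complex_add_cnj by (simp add: den_def G_def algebra_simps)
      finally show ?thesis .
    qed
    have num: "(X *\<^sub>v w \<tau>) \<bullet>c w \<tau> = p * of_real (den \<tau>) + (q - p) * of_real (num \<tau>)" for \<tau>
    proof -
      have st: "(X *\<^sub>v x) \<bullet>c y = (q - p) * s + p * g" "(X *\<^sub>v y) \<bullet>c x = (q - p) * t + p * cnj g"
        using False by (simp_all add: s_def t_def)
      have "(X *\<^sub>v w \<tau>) \<bullet>c w \<tau> = of_real ((1-\<tau>)\<^sup>2) * (c * cnj c) * p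
          + of_real (\<tau> * (1-\<tau>)) * ((q - p) * (c * s + cnj c * t) + p * (c * g + cnj (c * g)))
          + of_real (\<tau>\<^sup>2) * q"
        unfolding w_def quadratic_form_add_smult[OF X x(1) y(1)] st x(3)[symmetric] y(3)[symmetric]
        by (simp add: algebra_simps power2_eq_square)
      also have "c * s + cnj c * t = of_real R" unfolding R_def using c(2) by (metis of_real_Re)
      also have "c * g + cnj (c * g) = of_real (2 * G)"
        unfolding complex_add_cnj G_def by simp
      finally show ?thesis unfolding c(1) by (simp add: den_def num_def algebra_simps power2_eq_square)
    qed
    \<comment> \<open>At \<open>\<tau> = 1\<close> the path is at \<open>y\<close>. If it vanished
      elsewhere, \<open>x\<close> would be a unimodular multiple of \<open>y\<close>, and both would
      give the same value, against \<open>p \<noteq> q\<close>.\<close>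
    have nz: "w \<tau> \<noteq> 0\<^sub>v N" for \<tau>
    proof
      assume "w \<tau> = 0\<^sub>v N"
      then have "w \<tau> $ i = 0" if "i < N" for i using that by simp
      then have e: "(1 - \<tau>) * (c * x $ i) = - (\<tau> * y $ i)" if "i < N" for i
        using that x(1) y(1) by (simp add: w_def eq_neg_iff_add_eq_0 mult.assoc)
      show False
      proof (cases "\<tau> = 1")
        case True
        then have "y = 0\<^sub>v N" using e y(1) by (intro eq_vecI) auto
        then show False using y(2) by simp
      next
        case False
        define k where "k = - of_real (\<tau> / (1 - \<tau>)) * cnj c"
        have "x = k \<cdot>\<^sub>v y"
        proof (intro eq_vecI)
          fix i assume "i < dim_vec (k \<cdot>\<^sub>v y)"
          then have i: "i < N" using y by simp
          have n1: "1 - complex_of_real \<tau> \<noteq> 0" using False by (metis eq_iff_diff_eq_0 of_real_eq_1_iff)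
          have "(1 - \<tau>) * (c * cnj c) * x $ i = (1 - \<tau>) * (c * x $ i) * cnj c" by (simp add: mult_ac)
          also have "\<dots> = - (\<tau> * y $ i) * cnj c" unfolding e[OF i] by simp
          finally have "(1 - complex_of_real \<tau>) * x $ i = - (\<tau> * y $ i) * cnj c" unfolding c(1) by simp
          then have "x $ i = k * y $ i" using n1 by (simp add: k_def field_simps)
          then show "x $ i = (k \<cdot>\<^sub>v y) $ i" using i y by simp
        qed (use x y in simp)
        \<comment> \<open>The zero second term puts \<open>x\<close> into the two-term shape that
          \<open>quadratic_form_add_smult\<close> expands.\<close>
        then have kk: "x = k \<cdot>\<^sub>v y + 0 \<cdot>\<^sub>v y" using y by auto
        have "p = k * cnj k * q"
          unfolding x(3) y(3) unfolding kk quadratic_form_add_smult[OF X y(1) y(1)] by simp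
        moreover have "1 = k * cnj k"
          using x(2) quadratic_form_add_smult[OF one_carrier_mat y(1) y(1), of k 0] y(1,2) kk by simp
        ultimately show False using \<open>p \<noteq> q\<close> by simp
      qed
    qed
    have den_pos: "den \<tau> > 0" for \<tau> using cscalar_prod_self_pos(1)[OF wc nz] den by simp
    define h where "h \<tau> = num \<tau> / den \<tau>" for \<tau>
    have "continuous_on {0..1} h"
      unfolding h_def num_def den_def
      by (intro continuous_intros) (use den_pos in \<open>auto simp: den_def less_le\<close>)
    moreover have "h 0 = 0" "h 1 = 1" by (simp_all add: h_def num_def den_def)
    ultimately obtain \<tau> where \<tau>: "h \<tau> = v"
      using IVT'[of h 0 v 1] uv by auto
    have dn: "complex_of_real (den \<tau>) \<noteq> 0" using den_pos[of \<tau>] by simp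
    have "p + (q - p) * of_real (h \<tau>) \<in> numerical_range X"
      using numerical_range_normalize[OF X wc nz, of \<tau>] dn
      unfolding num den h_def by (simp add: add_divide_distrib)
    moreover have "p + (q - p) * of_real (h \<tau>) = u *\<^sub>R p + v *\<^sub>R q"
    proof -
      have u: "u = 1 - v" using uv by simp
      show ?thesis unfolding \<tau> u by (simp add: scaleR_conv_of_real algebra_simps)
    qed
    ultimately show ?thesis by simp
  qed
qed


text \<open>Vectors are replaced by functions on all naturals whose coordinates from
  \<open>N\<close> on are pinned to 0. The box \<open>B\<close> is then compact by Tychonoff, the
  unit sphere \<open>S\<close> is a closed part of it, and the range is the image of
  \<open>S\<close> under the continuous form \<open>\<phi>\<close>.\<close>

theorem compact_numerical_range:
  assumes X: "X \<in> carrier_mat N N"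
  shows "compact (numerical_range X)"
proof -
  define B :: "(nat \<Rightarrow> complex) set" where "B = PiE UNIV (\<lambda>i. if i < N then cball 0 1 else {0})"
  define S where "S = B \<inter> {f. (\<Sum>i<N. f i * cnj (f i)) = 1}"
  define \<phi> where "\<phi> f = (\<Sum>i<N. (\<Sum>j<N. X $$ (i, j) * f j) * cnj (f i))" for f :: "nat \<Rightarrow> complex"
  have coord: "continuous_on UNIV (\<lambda>f :: nat \<Rightarrow> complex. f i)" for i
    by (rule continuous_on_product_coordinates)
  have "compactin (product_topology (\<lambda>i. euclidean) UNIV) B"
    unfolding B_def compactin_PiE by auto
  then have "compact B" by (simp add: euclidean_product_topology)
  moreover have "closed {f :: nat \<Rightarrow> complex. (\<Sum>i<N. f i * cnj (f i)) = 1}"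
    by (intro closed_Collect_eq continuous_on_sum continuous_on_mult continuous_on_cnj coord
        continuous_on_const)
  ultimately have "compact S" unfolding S_def by (rule compact_Int_closed)
  moreover have "continuous_on S \<phi>"
    unfolding \<phi>_def
    by (intro continuous_on_sum continuous_on_mult continuous_on_cnj
        continuous_on_subset[OF coord] continuous_on_const subset_UNIV)
  ultimately have "compact (\<phi> ` S)" by (rule compact_continuous_image[rotated])
  moreover have "\<phi> ` S = numerical_range X"
  proof (intro equalityI subsetI)
    fix z assume "z \<in> \<phi> ` S"
    then obtain f where f: "f \<in> S" "z = \<phi> f" by blast
    have v: "vec N f \<in> carrier_vec N" by simp
    have "vec N f \<bullet>c vec N f = 1" using f(1) by (simp add: S_def cscalar_prod_sum[OF v])
    moreover have "(X *\<^sub>v vec N f) \<bullet>c vec N f = \<phi> f"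
      unfolding \<phi>_def cscalar_prod_sum[OF v]
      by (intro sum.cong refl) (simp add: mult_mat_vec_sum[OF X v] del: index_mult_mat_vec)
    ultimately show "z \<in> numerical_range X"
      unfolding numerical_range_iff[OF X] f(2) using v by metis
  next
    fix z assume "z \<in> numerical_range X"
    then obtain x where x: "x \<in> carrier_vec N" "x \<bullet>c x = 1" "z = (X *\<^sub>v x) \<bullet>c x"
      unfolding numerical_range_iff[OF X] by blast
    define f where "f i = (if i < N then x $ i else 0)" for i
    have 1: "(\<Sum>i<N. f i * cnj (f i)) = 1"
      using x(2) by (simp add: cscalar_prod_sum[OF x(1)] f_def)
    have "(\<Sum>i<N. (cmod (f i))\<^sup>2) = 1"
      using arg_cong[OF 1, of Re] by (simp add: complex_norm_square[symmetric] flip: of_real_power of_real_sum)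
    then have "(cmod (f i))\<^sup>2 \<le> 1" if "i < N" for i
      using that member_le_sum[of i "{..<N}" "\<lambda>i. (cmod (f i))\<^sup>2"] by simp
    then have "f i \<in> cball 0 1" if "i < N" for i
      using that power2_le_imp_le[of "cmod (f i)" 1] by simp
    then have "f \<in> S" using 1 by (auto simp: S_def B_def f_def)
    moreover have "\<phi> f = z"
      unfolding \<phi>_def x(3) cscalar_prod_sum[OF x(1)]
      by (intro sum.cong refl) (simp add: mult_mat_vec_sum[OF X x(1)] f_def del: index_mult_mat_vec)
    ultimately show "z \<in> \<phi> ` S" by blast
  qed
  ultimately show ?thesis by simp
qed

section \<open>Kernel equations at points of supporting lines\<close>

lemma linear_le_quadratic_imp_zero:
  fixes b c :: real
  assumes "\<And>e. 0 \<le> 2 * e * b + e\<^sup>2 * c"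
  shows "b = 0"
proof -
  define d where "d = \<bar>c\<bar> + 1"
  have d: "d > 0" "c < d" by (auto simp: d_def)
  \<comment> \<open>At \<open>e = - b / d\<close> the linear term contributes -2 b^2 / d, which the
    quadratic term cannot balance because \<open>c < d\<close>.\<close>
  have "0 \<le> 2 * (- b / d) * b + (- b / d)\<^sup>2 * c" by (rule assms)
  also have "\<dots> = (b / d)\<^sup>2 * (c - 2 * d)" using d by (simp add: power2_eq_square field_simps)
  finally have "b / d = 0"
    using d by (metis diff_less_0_iff_less less_add_same_cancel1 less_trans mult_2 mult_le_0_iff not_le
        zero_le_mult_iff zero_less_power2)
  then show ?thesis using d by simp
qed

text \<open>Moving from \<open>x\<close> by a real multiple \<open>e\<close> of G x changes the form
  by 2 e |G x|^2 plus a multiple of e^2. Since the form starts at 0 and never becomes negative, the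
  first-order coefficient |G x|^2 must vanish.\<close>

lemma semidefinite_isotropic_imp_kernel:
  fixes G :: "complex mat"
  assumes G: "G \<in> carrier_mat N N" and herm: "conj_transpose G = G"
    and pos: "\<And>x. x \<in> carrier_vec N \<Longrightarrow> 0 \<le> Re ((G *\<^sub>v x) \<bullet>c x)"
    and x: "x \<in> carrier_vec N" "Re ((G *\<^sub>v x) \<bullet>c x) = 0"
  shows "G *\<^sub>v x = 0\<^sub>v N"
proof -
  define y where "y = G *\<^sub>v x"
  have y: "y \<in> carrier_vec N" using G x by (simp add: y_def)
  define b where "b = Re (y \<bullet>c y)"
  have "(G *\<^sub>v y) \<bullet>c x = y \<bullet>c y"
    using cscalar_prod_conj_transpose[OF G y x(1)] herm by (simp add: y_def)
  then have "0 \<le> 2 * e * b + e\<^sup>2 * Re ((G *\<^sub>v y) \<bullet>c y)" for e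
    using pos[of "1 \<cdot>\<^sub>v x + of_real e \<cdot>\<^sub>v y"] x y
    unfolding quadratic_form_add_smult[OF G x(1) y]
    by (simp add: b_def power2_eq_square flip: y_def)
  then have "b = 0" by (rule linear_le_quadratic_imp_zero)
  then show ?thesis using cscalar_prod_self_pos(1)[OF y] by (auto simp: b_def y_def)
qed

text \<open>The matrix \<open>2 Re(conj \<nu> p) I - conj \<nu> X - \<nu> X*\<close> is semidefinite when the line through \<open>p\<close>
  with normal \<open>\<nu>\<close> supports the numerical range, and a unit vector realising \<open>p\<close> is isotropic for it.\<close>

lemma supporting_line_imp_kernel:
  assumes X: "X \<in> carrier_mat N N"
    and sup: "\<And>w. w \<in> numerical_range X \<Longrightarrow> Re (cnj \<nu> * w) \<le> Re (cnj \<nu> * ((X *\<^sub>v x) \<bullet>c x))"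
    and x: "x \<in> carrier_vec N" "x \<bullet>c x = 1"
  shows "cnj \<nu> \<cdot>\<^sub>v (X *\<^sub>v x) + \<nu> \<cdot>\<^sub>v (conj_transpose X *\<^sub>v x) =
    of_real (2 * Re (cnj \<nu> * ((X *\<^sub>v x) \<bullet>c x))) \<cdot>\<^sub>v x"
proof -
  define r where "r = Re (cnj \<nu> * ((X *\<^sub>v x) \<bullet>c x))"
  define H where "H = cnj \<nu> \<cdot>\<^sub>m X + \<nu> \<cdot>\<^sub>m conj_transpose X"
  define G where "G = of_real (2 * r) \<cdot>\<^sub>m 1\<^sub>m N - H"
  have H: "H \<in> carrier_mat N N" and G: "G \<in> carrier_mat N N" using X by (auto simp: H_def G_def intro!: minus_carrier_mat)
  have Hv: "H *\<^sub>v z = cnj \<nu> \<cdot>\<^sub>v (X *\<^sub>v z) + \<nu> \<cdot>\<^sub>v (conj_transpose X *\<^sub>v z)" if "z \<in> carrier_vec N" for z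
    unfolding H_def using X that by (simp add: add_mult_distrib_mat_vec[of _ N N] smult_mat_mult_mat_vec[of _ N N])
  have Hz: "(H *\<^sub>v z) \<bullet>c z = of_real (2 * Re (cnj \<nu> * ((X *\<^sub>v z) \<bullet>c z)))" if z: "z \<in> carrier_vec N" for z
  proof -
    have Xz: "X *\<^sub>v z \<in> carrier_vec N" "conj_transpose X *\<^sub>v z \<in> carrier_vec N"
      using X z by (auto intro!: mult_mat_vec_carrier[of _ N N])
    then have "(conj_transpose X *\<^sub>v z) \<bullet>c z = cnj ((X *\<^sub>v z) \<bullet>c z)"
      using cscalar_prod_conj_transpose[OF X z z] cscalar_prod_commute[OF z] by simp
    then have "(H *\<^sub>v z) \<bullet>c z = cnj \<nu> * ((X *\<^sub>v z) \<bullet>c z) + cnj (cnj \<nu> * ((X *\<^sub>v z) \<bullet>c z))"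
      using cscalar_prod_add_smult_left[OF Xz z] Hv[OF z] by simp
    then show ?thesis by (simp only: complex_add_cnj)
  qed
  have Gv: "G *\<^sub>v z = of_real (2 * r) \<cdot>\<^sub>v z - H *\<^sub>v z" if z: "z \<in> carrier_vec N" for z
    unfolding G_def using H z by (simp add: minus_mult_distrib_mat_vec[of _ N N] smult_mat_mult_mat_vec[of _ N N])
  have Gz: "(G *\<^sub>v z) \<bullet>c z = of_real (2 * r) * (z \<bullet>c z) - of_real (2 * Re (cnj \<nu> * ((X *\<^sub>v z) \<bullet>c z)))"
    if z: "z \<in> carrier_vec N" for z
  proof -
    have c: "conjugate z \<in> carrier_vec N" "of_real (2*r) \<cdot>\<^sub>v z \<in> carrier_vec N" "H *\<^sub>v z \<in> carrier_vec N"
      using z H by simp_all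
    show ?thesis unfolding Gv[OF z] using c z by (simp add: minus_scalar_prod_distrib[of _ N] Hz[OF z])
  qed
  have "G *\<^sub>v x = 0\<^sub>v N"
  proof (rule semidefinite_isotropic_imp_kernel[OF G _ _ x(1)])
    show "conj_transpose G = G"
      by (rule eq_matI) (use X in \<open>auto simp: G_def H_def conj_transpose_def\<close>)
    show "Re ((G *\<^sub>v x) \<bullet>c x) = 0" by (simp add: Gz[OF x(1)] x(2) r_def)
    fix z :: "complex vec" assume z: "z \<in> carrier_vec N"
    show "0 \<le> Re ((G *\<^sub>v z) \<bullet>c z)"
    proof (cases "z = 0\<^sub>v N")
      case True
      then show ?thesis using G by simp
    next
      case False
      define q where "q = Re (z \<bullet>c z)"
      have q: "q > 0" "z \<bullet>c z = of_real q" using cscalar_prod_self_pos[OF z False] by (simp_all add: q_def)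
      have "Re (cnj \<nu> * ((X *\<^sub>v z) \<bullet>c z / of_real q)) \<le> r"
        using sup[OF numerical_range_normalize[OF X z False]] q by (simp add: r_def)
      then have "Re (cnj \<nu> * ((X *\<^sub>v z) \<bullet>c z)) \<le> r * q"
        using q(1) by (simp add: field_simps)
      then show ?thesis by (simp add: Gz[OF z] q(2))
    qed
  qed
  then have "H *\<^sub>v x = of_real (2 * r) \<cdot>\<^sub>v x"
    unfolding Gv[OF x(1)] by (metis H carrier_vecD diff_eq_diff_eq dim_mult_mat_vec eq_vecI
      index_minus_vec(1) index_zero_vec(1) right_minus_eq x(1) carrier_matD(1) index_smult_vec(2))
  then show ?thesis unfolding Hv[OF x(1)] r_def .
qed

section \<open>Elliptic arcs in the boundary of a numerical range\<close>

text \<open>The determinant of the pencil, taken over matrices with polynomial entries, is one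
  polynomial in the parameter. Infinitely many singular members give it infinitely many roots, so it
  is zero and every member is singular.\<close>

lemma singular_pencil_poly:
  fixes p q r :: "complex poly"
  assumes X: "X \<in> carrier_mat N N" and Y: "Y \<in> carrier_mat N N" and Z: "infinite Z"
    and ex: "\<And>z. z \<in> Z \<Longrightarrow> \<exists>x\<in>carrier_vec N. x \<noteq> 0\<^sub>v N \<and>
      poly p z \<cdot>\<^sub>v (X *\<^sub>v x) + poly q z \<cdot>\<^sub>v (Y *\<^sub>v x) = poly r z \<cdot>\<^sub>v x"
  shows "\<exists>x\<in>carrier_vec N. x \<noteq> 0\<^sub>v N \<and>
      poly p z \<cdot>\<^sub>v (X *\<^sub>v x) + poly q z \<cdot>\<^sub>v (Y *\<^sub>v x) = poly r z \<cdot>\<^sub>v x"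
proof -
  define M where "M = mat N N (\<lambda>(i, j). Polynomial.smult (X $$ (i, j)) p + Polynomial.smult (Y $$ (i, j)) q - (if i = j then r else 0))"
  define D where "D w = map_mat (\<lambda>p. poly p w) M" for w
  have D: "D w \<in> carrier_mat N N" for w by (simp add: D_def M_def)
  have det: "det (D w) = poly (det M) w" for w
  proof -
    interpret comm_ring_hom "\<lambda>p. poly p w" by unfold_locales auto
    show ?thesis by (simp add: D_def)
  qed
  have Dx: "D w *\<^sub>v x = 0\<^sub>v N \<longleftrightarrow>
      poly p w \<cdot>\<^sub>v (X *\<^sub>v x) + poly q w \<cdot>\<^sub>v (Y *\<^sub>v x) = poly r w \<cdot>\<^sub>v x" if x: "x \<in> carrier_vec N" for w x
  proof -
    have "(D w *\<^sub>v x) $ i = poly p w * (X *\<^sub>v x) $ i + poly q w * (Y *\<^sub>v x) $ i - poly r w * x $ i"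
      if "i < N" for i
    proof -
      have "(D w *\<^sub>v x) $ i = (\<Sum>j<N. poly p w * (X $$ (i, j) * x $ j) + poly q w * (Y $$ (i, j) * x $ j)
          - (if i = j then poly r w * x $ j else 0))"
        unfolding mult_mat_vec_sum[OF D x that]
        by (intro sum.cong refl) (auto simp: D_def M_def that algebra_simps)
      also have "\<dots> = poly p w * (X *\<^sub>v x) $ i + poly q w * (Y *\<^sub>v x) $ i - poly r w * x $ i"
        unfolding mult_mat_vec_sum[OF X x that] mult_mat_vec_sum[OF Y x that]
        using that by (simp add: sum.distrib sum_subtractf sum_distrib_left)
      finally show ?thesis .
    qed
    then show ?thesis
      using D[of w] X Y x by (auto simp: Matrix.vec_eq_iff simp del: index_mult_mat_vec)
  qed
  have "poly (det M) w = 0" if "w \<in> Z" for w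
    using ex[OF that] det_0_iff_vec_prod_zero_field[OF D[of w]] Dx by (auto simp flip: det)
  then have "Z \<subseteq> {w. poly (det M) w = 0}" by blast
  then have "det M = 0" using Z poly_roots_finite finite_subset by blast
  then have "det (D z) = 0" by (simp add: det)
  then show ?thesis using det_0_iff_vec_prod_zero_field[OF D[of z]] Dx by blast
qed

section \<open>Supporting normals and parametrised elliptic arcs\<close>

lemma frontier_supporting_normal:
  fixes S :: "complex set"
  assumes S: "convex S" and p: "p \<in> frontier S"
  obtains \<nu> where "\<nu> \<noteq> 0" "\<And>w. w \<in> S \<Longrightarrow> Re (cnj \<nu> * w) \<le> Re (cnj \<nu> * p)"
proof (cases "interior S = {}")
  \<comment> \<open>A flat \<open>S\<close> lies on a line, whose normal supports it at each point
    with equality throughout. In the other case interior and relative interior agree, so the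
    supporting hyperplane at a relative frontier point applies.\<close>
  case True
  then obtain a b where a: "a \<noteq> 0" "S \<subseteq> {x. inner a x = b}"
    using empty_interior_subset_hyperplane[OF S] by blast
  then have "closure S \<subseteq> {x. inner a x = b}"
    by (intro closure_minimal closed_hyperplane)
  then have "inner a p = b" using p by (auto simp: frontier_def)
  then show ?thesis
    using a by (intro that[of a]) (auto simp: inner_complex_def)
next
  case False
  then have "p \<notin> rel_interior S" "p \<in> closure S"
    using p by (auto simp: frontier_def rel_interior_nonempty_interior)
  then obtain a where a: "a \<noteq> 0" "\<And>y. y \<in> closure S \<Longrightarrow> inner a p \<le> inner a y"
    using supporting_hyperplane_relative_frontier[OF S] by metis
  show ?thesis
    using a(1) a(2)[OF closure_subset[THEN subsetD]]
    by (intro that[of "- a"]) (fastforce simp: inner_complex_def)+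
qed

text \<open>\<open>\<phi>\<close> is the eccentric angle, not the polar one: points and normals of
  the ellipse are then linear in \<open>cis \<phi>\<close> and its inverse, which is what later
  produces polynomials.\<close>

definition ellipse_point :: "complex \<Rightarrow> real \<Rightarrow> real \<Rightarrow> real \<Rightarrow> real \<Rightarrow> complex" where
  "ellipse_point z0 t a b \<phi> = z0 + cis t * Complex (a * cos \<phi>) (b * sin \<phi>)"

text \<open>After undoing the rigid motion the disk is a sublevel set of the continuous function
  \<open>Q\<close>. The strict sublevel set is open, hence interior, so a frontier point can only
  have the value 1.\<close>

lemma frontier_elliptic_disk:
  assumes a: "a > 0" and b: "b > 0"
    and p: "p \<in> frontier {z0 + cis t * Complex (a * u) (b * v) | u v. u\<^sup>2 + v\<^sup>2 \<le> 1}"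
  shows "(Re (cis (- t) * (p - z0)) / a)\<^sup>2 + (Im (cis (- t) * (p - z0)) / b)\<^sup>2 = 1"
proof -
  define Q where "Q p = (Re (cis (- t) * (p - z0)) / a)\<^sup>2 + (Im (cis (- t) * (p - z0)) / b)\<^sup>2" for p
  have "{z0 + cis t * Complex (a * u) (b * v) | u v. u\<^sup>2 + v\<^sup>2 \<le> 1} = {p. Q p \<le> 1}"
  proof (intro equalityI subsetI)
    fix p assume "p \<in> {z0 + cis t * Complex (a * u) (b * v) | u v. u\<^sup>2 + v\<^sup>2 \<le> 1}"
    then obtain u v where uv: "u\<^sup>2 + v\<^sup>2 \<le> 1" "p = z0 + cis t * Complex (a * u) (b * v)" by blast
    have "cis (- t) * (p - z0) = (cis (- t) * cis t) * Complex (a * u) (b * v)"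
      unfolding uv(2) by (simp only: add_diff_cancel_left' mult.assoc)
    then have "cis (- t) * (p - z0) = Complex (a * u) (b * v)" by (simp add: cis_mult)
    then have "Q p = u\<^sup>2 + v\<^sup>2" using a b by (simp only: Q_def complex.sel) simp
    then show "p \<in> {p. Q p \<le> 1}" using uv(1) by simp
  next
    fix p assume p: "p \<in> {p. Q p \<le> 1}"
    define u v where "u = Re (cis (- t) * (p - z0)) / a" and "v = Im (cis (- t) * (p - z0)) / b"
    have "Complex (a * u) (b * v) = cis (- t) * (p - z0)"
      using a b unfolding u_def v_def by (simp add: complex_eq_iff)
    then have "z0 + cis t * Complex (a * u) (b * v) = z0 + (cis t * cis (- t)) * (p - z0)"
      by (simp only: mult.assoc)
    then have "p = z0 + cis t * Complex (a * u) (b * v)" by (simp add: cis_mult)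
    moreover have "u\<^sup>2 + v\<^sup>2 \<le> 1" using p by (simp add: Q_def u_def v_def)
    ultimately show "p \<in> {z0 + cis t * Complex (a * u) (b * v) | u v. u\<^sup>2 + v\<^sup>2 \<le> 1}" by blast
  qed
  moreover have Q: "continuous_on UNIV Q"
    unfolding Q_def using a b by (intro continuous_intros) auto
  then have "closed {p. Q p \<le> 1}" by (intro closed_Collect_le continuous_on_const)
  moreover have "open {p. Q p < 1}" using Q by (intro open_Collect_less continuous_on_const)
  then have "{p. Q p < 1} \<subseteq> interior {p. Q p \<le> 1}" by (intro interior_maximal) auto
  ultimately have "Q p \<le> 1" "\<not> Q p < 1" using p by (auto simp: frontier_def)
  then show ?thesis by (simp add: Q_def)
qed

text \<open>Near its initial point the arc stays in a half-plane through the centre, where the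
  angle is a continuous function; its image is an interval.\<close>

lemma elliptic_arc_contains_angles:
  assumes "elliptic_arc S"
  obtains z0 t a b \<alpha> \<beta> where "a > 0" "b > 0" "\<alpha> < \<beta>"
    "\<And>\<phi>. \<alpha> < \<phi> \<Longrightarrow> \<phi> < \<beta> \<Longrightarrow> ellipse_point z0 t a b \<phi> \<in> S"
proof -
  obtain E g where E: "elliptic_disk E" and g: "arc g" "path_image g \<subseteq> frontier E" "S = path_image g"
    using assms unfolding elliptic_arc_def by blast
  obtain z0 t a b where ab: "a > 0" "b > 0"
    and Eq: "E = {z0 + cis t * Complex (a * u) (b * v) | u v. u\<^sup>2 + v\<^sup>2 \<le> 1}"
    using E unfolding elliptic_disk_def by blast
  \<comment> \<open>\<open>h\<close> is the arc pulled back to the unit circle.\<close>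
  define h where "h s = Complex (Re (cis (- t) * (g s - z0)) / a) (Im (cis (- t) * (g s - z0)) / b)" for s
  have gh: "g s = z0 + cis t * Complex (a * Re (h s)) (b * Im (h s))" for s
  proof -
    have "Complex (a * Re (h s)) (b * Im (h s)) = cis (- t) * (g s - z0)"
      using ab unfolding h_def by (simp add: complex_eq_iff)
    then have "z0 + cis t * Complex (a * Re (h s)) (b * Im (h s)) = z0 + (cis t * cis (- t)) * (g s - z0)"
      by (simp only: mult.assoc)
    then show ?thesis by (simp add: cis_mult)
  qed
  have gS: "g s \<in> S" if "0 \<le> s" "s \<le> 1" for s
    using that g(3) by (auto simp: path_image_def)
  have h1: "cmod (h s) = 1" if "0 \<le> s" "s \<le> 1" for s
  proof -
    have "g s \<in> frontier E" using gS[OF that] g by blast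
    from frontier_elliptic_disk[OF ab this[unfolded Eq]] show ?thesis
      by (simp add: h_def cmod_def)
  qed
  have "continuous_on {0..1} g" using g(1) by (simp add: arc_def path_def)
  then have ch: "continuous_on {0..1} h"
    unfolding h_def Complex_eq using ab by (intro continuous_intros) auto
  \<comment> \<open>Dividing by the initial point makes the path start at 1, away from the branch
    cut of \<open>Arg\<close>.\<close>
  define k where "k s = h s / h 0" for s
  have h0: "h 0 \<noteq> 0" using h1[of 0] by auto
  have ck: "continuous_on {0..1} k" unfolding k_def using h0 by (intro continuous_intros ch) auto
  have k0: "k 0 = 1" using h0 by (simp add: k_def)
  have k1: "cmod (k s) = 1" if "0 \<le> s" "s \<le> 1" for s
    using h1[OF that] h1[of 0] by (simp add: k_def norm_divide)
  obtain d where d: "d > 0" "\<And>s. s \<in> {0..1} \<Longrightarrow> dist s 0 < d \<Longrightarrow> dist (k s) (k 0) < 1"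
    using ck[unfolded continuous_on_iff, rule_format, of 0 1] by auto
  define e where "e = min 1 (d / 2)"
  have e: "0 < e" "e \<le> 1" "e < d" using d by (auto simp: e_def)
  have Rek: "Re (k s) > 0" if "0 \<le> s" "s \<le> e" for s
  proof -
    have "cmod (k s - 1) < 1" using d(2)[of s] that e by (simp add: k0 dist_norm)
    then show ?thesis using abs_Re_le_cmod[of "k s - 1"] by simp
  qed
  have cA: "continuous_on {0..e} (\<lambda>s. Arg (k s))"
  proof (rule continuous_on_compose2[of "{z. Re z > 0}" Arg])
    show "continuous_on {z. Re z > 0} Arg"
      by (intro continuous_at_imp_continuous_on ballI continuous_at_Arg)
         (auto simp: complex_nonpos_Reals_iff)
    show "continuous_on {0..e} k" using ck e by (auto intro: continuous_on_subset)
  qed (use Rek in auto)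
  define \<theta> where "\<theta> = Arg (k e)"
  have Argk: "cis (Arg (k s)) = k s" if "0 \<le> s" "s \<le> 1" for s
    using k1[OF that] cis_Arg[of "k s"] by (cases "k s = 0") (auto simp: sgn_eq)
  \<comment> \<open>This is where injectivity of the arc enters: angle 0 at \<open>e\<close> would
    mean \<open>g e = g 0\<close>.\<close>
  have "\<theta> \<noteq> 0"
  proof
    assume "\<theta> = 0"
    then have "k e = 1" using Argk[of e] e by (simp add: \<theta>_def)
    then have "h e = h 0" using h0 by (simp add: k_def)
    then have "g e = g 0" using gh by metis
    then show False using g(1) e by (auto simp: arc_def dest: inj_onD[of g "{0..1}" e 0])
  qed
  have A0: "Arg (k 0) = 0" by (simp add: k0)
  \<comment> \<open>The arc may run in either direction, hence \<open>min\<close>,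
    \<open>max\<close> and the two forms of the intermediate value theorem.\<close>
  have val: "\<exists>s. 0 \<le> s \<and> s \<le> e \<and> Arg (k s) = y" if "min 0 \<theta> < y" "y < max 0 \<theta>" for y
  proof (cases "\<theta> > 0")
    case True
    then show ?thesis
      using IVT'[OF _ _ _ cA, of y] that e A0 by (auto simp: \<theta>_def)
  next
    case False
    then show ?thesis
      using IVT2'[OF _ _ _ cA, of y] that e A0 by (auto simp: \<theta>_def)
  qed
  define \<phi>0 where "\<phi>0 = Arg (h 0)"
  show ?thesis
  proof (rule that[OF ab])
    show "\<phi>0 + min 0 \<theta> < \<phi>0 + max 0 \<theta>" using \<open>\<theta> \<noteq> 0\<close> by auto
    fix \<phi> assume "\<phi>0 + min 0 \<theta> < \<phi>" "\<phi> < \<phi>0 + max 0 \<theta>"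
    then obtain s where s: "0 \<le> s" "s \<le> e" "Arg (k s) = \<phi> - \<phi>0"
      using val[of "\<phi> - \<phi>0"] by auto
    have "h s = h 0 * k s" using h0 by (simp add: k_def)
    also have "h 0 = cis \<phi>0" using h1[of 0] h0 cis_Arg[of "h 0"] by (simp add: \<phi>0_def sgn_eq)
    also have "k s = cis (\<phi> - \<phi>0)" using Argk[of s] s e by simp
    finally have "h s = cis \<phi>" by (simp add: cis_mult)
    then have "g s = ellipse_point z0 t a b \<phi>"
      by (simp add: gh[of s] ellipse_point_def)
    then show "ellipse_point z0 t a b \<phi> \<in> S" using gS[of s] s e by simp
  qed
qed

text \<open>A linear functional maximal at an inner parameter of the arc has zero derivative there,
  which forces its coefficients to be proportional to those of the geometric normal. Only this
  first-order condition is used, so the sign of \<open>k\<close> stays open; it is settled later by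
  a point known to lie in the range.\<close>

lemma ellipse_supporting_normal:
  assumes ab: "a > 0" "b > 0" and \<phi>: "\<alpha> < \<phi>" "\<phi> < \<beta>" and nu: "\<nu> \<noteq> 0"
    and max: "\<And>\<psi>. \<alpha> < \<psi> \<Longrightarrow> \<psi> < \<beta> \<Longrightarrow>
      Re (cnj \<nu> * ellipse_point z0 t a b \<psi>) \<le> Re (cnj \<nu> * ellipse_point z0 t a b \<phi>)"
  obtains k :: real where "k \<noteq> 0" "\<nu> = of_real k * (cis t * Complex (b * cos \<phi>) (a * sin \<phi>))"
proof -
  define c d where "c = Re (cis (- t) * \<nu>)" and "d = Im (cis (- t) * \<nu>)"
  have "\<nu> = (cis t * cis (- t)) * \<nu>" by (simp add: cis_mult)
  also have "\<dots> = cis t * (cis (- t) * \<nu>)" by (rule mult.assoc)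
  also have "cis (- t) * \<nu> = Complex c d" by (simp only: c_def d_def complex.collapse)
  finally have nu_eq: "\<nu> = cis t * Complex c d" .
  define f where "f \<psi> = Re (cnj \<nu> * z0) + c * (a * cos \<psi>) + d * (b * sin \<psi>)" for \<psi>
  have f: "Re (cnj \<nu> * ellipse_point z0 t a b \<psi>) = f \<psi>" for \<psi>
  proof -
    have "cnj \<nu> * ellipse_point z0 t a b \<psi>
        = cnj \<nu> * z0 + (cis (- t) * cis t) * (cnj (Complex c d) * Complex (a * cos \<psi>) (b * sin \<psi>))"
      unfolding ellipse_point_def nu_eq by (simp add: algebra_simps cis_cnj)
    also have "cis (- t) * cis t = 1" by (simp add: cis_mult)
    finally show ?thesis by (simp add: f_def)
  qed
  define l where "l = - c * (a * sin \<phi>) + d * (b * cos \<phi>)"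
  have der: "(f has_real_derivative l) (at \<phi>)"
    unfolding f_def l_def by (auto intro!: derivative_eq_intros)
  have "l = 0"
  proof (rule DERIV_local_max[OF der])
    show "0 < min (\<phi> - \<alpha>) (\<beta> - \<phi>)" using \<phi> by simp
    show "\<forall>y. \<bar>\<phi> - y\<bar> < min (\<phi> - \<alpha>) (\<beta> - \<phi>) \<longrightarrow> f y \<le> f \<phi>"
      using max by (auto simp flip: f)
  qed
  then have l: "c * a * sin \<phi> = d * b * cos \<phi>" by (simp add: l_def)
  define n where "n = (b * cos \<phi>)\<^sup>2 + (a * sin \<phi>)\<^sup>2"
  have n: "n > 0"
  proof -
    have "cos \<phi> \<noteq> 0 \<or> sin \<phi> \<noteq> 0" by (metis sin_zero_norm_cos_one norm_zero zero_neq_one)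
    then show ?thesis using ab unfolding n_def by (auto simp: sum_power2_gt_zero_iff)
  qed
  \<comment> \<open>The coefficient of the orthogonal projection of (c, d) onto the normal
    direction, to which (c, d) is already parallel by \<open>l\<close>.\<close>
  define k where "k = (c * (b * cos \<phi>) + d * (a * sin \<phi>)) / n"
  have "k * (b * cos \<phi>) = c" "k * (a * sin \<phi>) = d"
  proof -
    have "(c * (b * cos \<phi>) + d * (a * sin \<phi>)) * (b * cos \<phi>) = c * (b * cos \<phi>)\<^sup>2 + (d * b * cos \<phi>) * (a * sin \<phi>)"
      by (simp add: power2_eq_square algebra_simps)
    also have "\<dots> = c * n" unfolding l[symmetric] by (simp add: n_def power2_eq_square algebra_simps)
    finally show "k * (b * cos \<phi>) = c" using n by (simp add: k_def field_simps)
    have "(c * (b * cos \<phi>) + d * (a * sin \<phi>)) * (a * sin \<phi>) = (c * a * sin \<phi>) * (b * cos \<phi>) + d * (a * sin \<phi>)\<^sup>2"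
      by (simp add: power2_eq_square algebra_simps)
    also have "\<dots> = d * n" unfolding l by (simp add: n_def power2_eq_square algebra_simps)
    finally show "k * (a * sin \<phi>) = d" using n by (simp add: k_def field_simps)
  qed
  then have "of_real k * Complex (b * cos \<phi>) (a * sin \<phi>) = Complex c d"
    by (simp add: complex_eq_iff)
  then have *: "\<nu> = of_real k * (cis t * Complex (b * cos \<phi>) (a * sin \<phi>))"
    unfolding nu_eq by (metis mult.left_commute)
  then have "k \<noteq> 0" using nu by auto
  then show ?thesis using * that by blast
qed


section \<open>The singular pencil attached to an elliptic arc\<close>

lemma infinite_cis_image:
  assumes "\<alpha> < \<beta>"
  shows "infinite (cis ` {\<alpha><..<\<beta>})"
proof -
  \<comment> \<open>Differences inside \<open>J\<close> stay below 1, hence below pi, where the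
    cosine takes the value 1 only at 0.\<close>
  define J where "J = {\<alpha><..<min \<beta> (\<alpha> + 1)}"
  have "inj_on cis J"
  proof (rule inj_onI)
    fix u v assume uv: "u \<in> J" "v \<in> J" "cis u = cis v"
    have "cis (u - v) = cis u / cis v" by (simp add: cis_divide)
    also have "\<dots> = 1" using uv(3) by simp
    finally have "cos (u - v) = 1" by (simp add: complex_eq_iff)
    moreover have "\<bar>u - v\<bar> < 1" using uv by (auto simp: J_def)
    ultimately show "u = v"
      using cos_inj_pi[of "\<bar>u - v\<bar>" 0] pi_gt3 by auto
  qed
  moreover have "infinite J" using assms by (simp add: J_def infinite_Ioo)
  ultimately have "infinite (cis ` J)" using finite_image_iff by blast
  moreover have "cis ` J \<subseteq> cis ` {\<alpha><..<\<beta>}" by (intro image_mono) (auto simp: J_def)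
  ultimately show ?thesis using finite_subset by blast
qed

text \<open>With z = \<open>cis \<phi>\<close> the unrotated normal is P z + Q / z for P = (a + b) /
  2 and Q = (b - a) / 2, so multiplying by z leaves quadratic polynomials. The summand
  \<open>2 * of_real (a * b) * z\<close> comes from the support function of the ellipse about its
  centre, the remaining ones from the shift by \<open>z0\<close>. The supporting inequalities are
  exported as well, because a later test vector has to be compared with them.\<close>

lemma elliptic_arc_frontier_imp_pencil:
  assumes X: "X \<in> carrier_mat N N" and arc: "elliptic_arc S" "S \<subseteq> frontier (numerical_range X)"
  obtains z0 t a b \<alpha> \<beta> where "a > 0" "b > 0" "\<alpha> < \<beta>"
    "\<forall>\<phi>. \<alpha> < \<phi> \<longrightarrow> \<phi> < \<beta> \<longrightarrow> (\<exists>k::real. k \<noteq> 0 \<and> (\<forall>w\<in>numerical_range X.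
        Re (cnj (of_real k * (cis t * Complex (b * cos \<phi>) (a * sin \<phi>))) * w) \<le>
        Re (cnj (of_real k * (cis t * Complex (b * cos \<phi>) (a * sin \<phi>))) * ellipse_point z0 t a b \<phi>)))"
    "\<forall>z. \<exists>x\<in>carrier_vec N. x \<noteq> 0\<^sub>v N \<and>
      (cis (- t) * (of_real ((a + b) / 2) + of_real ((b - a) / 2) * z\<^sup>2)) \<cdot>\<^sub>v (X *\<^sub>v x) +
      (cis t * (of_real ((a + b) / 2) * z\<^sup>2 + of_real ((b - a) / 2))) \<cdot>\<^sub>v (conj_transpose X *\<^sub>v x) =
      (2 * of_real (a * b) * z + cis (- t) * (of_real ((a + b) / 2) + of_real ((b - a) / 2) * z\<^sup>2) * z0
        + cis t * (of_real ((a + b) / 2) * z\<^sup>2 + of_real ((b - a) / 2)) * cnj z0) \<cdot>\<^sub>v x"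
proof -
  let ?W = "numerical_range X"
  obtain z0 t a b \<alpha> \<beta> where ab: "a > 0" "b > 0" and I: "\<alpha> < \<beta>"
    and pS: "\<And>\<phi>. \<alpha> < \<phi> \<Longrightarrow> \<phi> < \<beta> \<Longrightarrow> ellipse_point z0 t a b \<phi> \<in> S"
    using elliptic_arc_contains_angles[OF arc(1)] by metis
  define p where "p = ellipse_point z0 t a b"
  define n where "n \<phi> = cis t * Complex (b * cos \<phi>) (a * sin \<phi>)" for \<phi>
  define P Q :: complex where "P = of_real ((a + b) / 2)" and "Q = of_real ((b - a) / 2)"
  define \<beta>' \<gamma> where "\<beta>' z = cis (- t) * (P + Q * z\<^sup>2)" and "\<gamma> z = cis t * (P * z\<^sup>2 + Q)" for z
  have pf: "p \<phi> \<in> frontier ?W" if "\<alpha> < \<phi>" "\<phi> < \<beta>" for \<phi>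
    using pS[OF that] arc(2) by (auto simp: p_def)
  \<comment> \<open>Closedness puts the frontier points into the range, so each is attained by a
    unit vector, as the kernel equation requires.\<close>
  have "closed ?W" using compact_numerical_range[OF X] by (rule compact_imp_closed)
  then have pW: "p \<phi> \<in> ?W" if "\<alpha> < \<phi>" "\<phi> < \<beta>" for \<phi>
    using pf[OF that] by (auto simp: frontier_def)
  have normal: "\<exists>k::real. k \<noteq> 0 \<and>
      (\<forall>w\<in>?W. Re (cnj (of_real k * n \<phi>) * w) \<le> Re (cnj (of_real k * n \<phi>) * p \<phi>))"
    if phi: "\<alpha> < \<phi>" "\<phi> < \<beta>" for \<phi>
  proof -
    obtain \<nu> where nu: "\<nu> \<noteq> 0" "\<And>w. w \<in> ?W \<Longrightarrow> Re (cnj \<nu> * w) \<le> Re (cnj \<nu> * p \<phi>)"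
      using frontier_supporting_normal[OF convex_numerical_range[OF X] pf[OF phi]] by metis
    obtain k :: real where "k \<noteq> 0" "\<nu> = of_real k * n \<phi>"
      unfolding n_def
      by (rule ellipse_supporting_normal[OF ab phi nu(1), of z0 t]) (use nu(2) pW in \<open>auto simp: p_def\<close>)
    then show ?thesis using nu(2) by blast
  qed
  have ev: "\<exists>x\<in>carrier_vec N. x \<noteq> 0\<^sub>v N \<and> \<beta>' z \<cdot>\<^sub>v (X *\<^sub>v x) + \<gamma> z \<cdot>\<^sub>v (conj_transpose X *\<^sub>v x) =
      (2 * of_real (a * b) * z + \<beta>' z * z0 + \<gamma> z * cnj z0) \<cdot>\<^sub>v x"
    if phi: "\<alpha> < \<phi>" "\<phi> < \<beta>" and z: "z = cis \<phi>" for \<phi> z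
  proof -
    obtain k :: real where k: "k \<noteq> 0"
      "\<And>w. w \<in> ?W \<Longrightarrow> Re (cnj (of_real k * n \<phi>) * w) \<le> Re (cnj (of_real k * n \<phi>) * p \<phi>)"
      using normal[OF phi] by blast
    obtain x where x: "x \<in> carrier_vec N" "x \<bullet>c x = 1" "p \<phi> = (X *\<^sub>v x) \<bullet>c x"
      using pW[OF phi] numerical_range_iff[OF X] by blast
    have c: "X *\<^sub>v x \<in> carrier_vec N" "conj_transpose X *\<^sub>v x \<in> carrier_vec N"
      using X x by (auto intro!: mult_mat_vec_carrier[of _ N N])
    have nz: "n \<phi> * z = \<gamma> z" "cnj (n \<phi>) * z = \<beta>' z"
    proof -
      have zz: "cis \<phi> * cis \<phi> = cis (\<phi> + \<phi>)" by (simp add: cis_mult)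
      have C: "Complex (b * cos \<phi>) (a * sin \<phi>) = P * cis \<phi> + Q * cis (- \<phi>)"
        by (simp add: complex_eq_iff P_def Q_def algebra_simps flip: of_real_add of_real_diff of_real_divide)
           (simp add: field_simps)
      have D: "cis (- \<phi>) * cis \<phi> = 1" by (simp add: cis_mult)
      have "n \<phi> * z = cis t * (P * (cis \<phi> * cis \<phi>) + Q * (cis (- \<phi>) * cis \<phi>))"
        unfolding n_def C z by (simp only: algebra_simps)
      then show "n \<phi> * z = \<gamma> z" unfolding D \<gamma>_def z by (simp add: power2_eq_square)
      have "cnj (n \<phi>) = cis (- t) * (P * cis (- \<phi>) + Q * cis \<phi>)"
        unfolding n_def C by (simp add: cis_cnj P_def Q_def)
      then have "cnj (n \<phi>) * z = cis (- t) * (P * (cis (- \<phi>) * cis \<phi>) + Q * (cis \<phi> * cis \<phi>))"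
        unfolding z by (simp only: algebra_simps)
      then show "cnj (n \<phi>) * z = \<beta>' z" unfolding D \<beta>'_def z by (simp add: power2_eq_square)
    qed
    have np: "of_real (2 * Re (cnj (n \<phi>) * p \<phi>)) * z = 2 * of_real (a * b) * z + \<beta>' z * z0 + \<gamma> z * cnj z0"
    proof -
      have double: "complex_of_real (2 * u) = 2 * of_real w + of_real (2 * v)" if "u = v + w" for u v w
        using that by simp
      define d where "d = Complex (a * cos \<phi>) (b * sin \<phi>)"
      have "cnj (n \<phi>) * p \<phi> = cnj (n \<phi>) * z0 + (cis (- t) * cis t) * (cnj (Complex (b * cos \<phi>) (a * sin \<phi>)) * d)"
        unfolding p_def ellipse_point_def n_def d_def by (simp add: cis_cnj algebra_simps)
      also have "cis (- t) * cis t = 1" by (simp add: cis_mult)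
      finally have "Re (cnj (n \<phi>) * p \<phi>) = Re (cnj (n \<phi>) * z0) +
          Re (cnj (Complex (b * cos \<phi>) (a * sin \<phi>)) * d)"
        by (simp only: plus_complex.sel mult_1)
      also have "Re (cnj (Complex (b * cos \<phi>) (a * sin \<phi>)) * d) = a * b * ((cos \<phi>)\<^sup>2 + (sin \<phi>)\<^sup>2)"
        by (simp only: d_def complex_cnj times_complex.sel complex.sel power2_eq_square mult_minus_left diff_minus_eq_add)
           (simp only: algebra_simps)
      also have "\<dots> = a * b" by simp
      finally have "Re (cnj (n \<phi>) * p \<phi>) = Re (cnj (n \<phi>) * z0) + a * b" .
      then have "complex_of_real (2 * Re (cnj (n \<phi>) * p \<phi>)) = 2 * of_real (a * b) + of_real (2 * Re (cnj (n \<phi>) * z0))"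
        by (rule double)
      also have "of_real (2 * Re (cnj (n \<phi>) * z0)) = cnj (n \<phi>) * z0 + n \<phi> * cnj z0"
        using complex_add_cnj[of "cnj (n \<phi>) * z0"] by (simp only: complex_cnj_mult complex_cnj_cnj)
      finally show ?thesis unfolding nz[symmetric] by (simp add: algebra_simps)
    qed
    have "cnj (of_real k * n \<phi>) \<cdot>\<^sub>v (X *\<^sub>v x) + (of_real k * n \<phi>) \<cdot>\<^sub>v (conj_transpose X *\<^sub>v x) =
        of_real (2 * Re (cnj (of_real k * n \<phi>) * p \<phi>)) \<cdot>\<^sub>v x" (is "?L = ?R")
      unfolding x(3)
      by (rule supporting_line_imp_kernel[OF X _ x(1,2)]) (use k(2) x(3) in simp)
    \<comment> \<open>This factor cancels the unknown real \<open>k\<close> and clears the inverse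
      power of \<open>z\<close> at once.\<close>
    then have "(z / of_real k) \<cdot>\<^sub>v ?L = (z / of_real k) \<cdot>\<^sub>v ?R" by simp
    moreover have "(z / of_real k) \<cdot>\<^sub>v ?L = (cnj (n \<phi>) * z) \<cdot>\<^sub>v (X *\<^sub>v x) + (n \<phi> * z) \<cdot>\<^sub>v (conj_transpose X *\<^sub>v x)"
      using c k(1) by (simp add: smult_add_distrib_vec[of _ N] smult_smult_assoc mult_ac)
    moreover have "(z / of_real k) \<cdot>\<^sub>v ?R = (of_real (2 * Re (cnj (n \<phi>) * p \<phi>)) * z) \<cdot>\<^sub>v x"
    proof -
      have "cnj (of_real k * n \<phi>) * p \<phi> = of_real k * (cnj (n \<phi>) * p \<phi>)" by simp
      then have "Re (cnj (of_real k * n \<phi>) * p \<phi>) = k * Re (cnj (n \<phi>) * p \<phi>)"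
        by (simp only: times_complex.sel Re_complex_of_real Im_complex_of_real)
      then show ?thesis using k(1) by (simp add: smult_smult_assoc mult_ac)
    qed
    ultimately have "\<beta>' z \<cdot>\<^sub>v (X *\<^sub>v x) + \<gamma> z \<cdot>\<^sub>v (conj_transpose X *\<^sub>v x) =
        (2 * of_real (a * b) * z + \<beta>' z * z0 + \<gamma> z * cnj z0) \<cdot>\<^sub>v x"
      unfolding nz np by simp
    moreover have "x \<noteq> 0\<^sub>v N" using x by auto
    ultimately show ?thesis using x(1) by blast
  qed
  have inf: "infinite (cis ` {\<alpha><..<\<beta>})" using I by (rule infinite_cis_image)
  define pb pg pc :: "complex poly" where
    "pb = [:cis (- t) * P, 0, cis (- t) * Q:]" and "pg = [:cis t * Q, 0, cis t * P:]"
    and "pc = [:0, 2 * of_real (a * b):] + Polynomial.smult z0 pb + Polynomial.smult (cnj z0) pg"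
  have poly: "poly pb z = \<beta>' z" "poly pg z = \<gamma> z"
    "poly pc z = 2 * of_real (a * b) * z + \<beta>' z * z0 + \<gamma> z * cnj z0" for z
    by (simp_all add: pb_def pg_def pc_def \<beta>'_def \<gamma>_def power2_eq_square algebra_simps)
  have Y: "conj_transpose X \<in> carrier_mat N N" using X by simp
  have "\<exists>x\<in>carrier_vec N. x \<noteq> 0\<^sub>v N \<and>
      poly pb z \<cdot>\<^sub>v (X *\<^sub>v x) + poly pg z \<cdot>\<^sub>v (conj_transpose X *\<^sub>v x) = poly pc z \<cdot>\<^sub>v x" for z
    by (rule singular_pencil_poly[OF X Y inf]) (unfold poly, use ev in auto)
  note pencil = this[unfolded poly \<beta>'_def \<gamma>_def P_def Q_def]
  show ?thesis
    by (rule that[OF ab I]) (use normal pencil in \<open>unfold n_def p_def, blast+\<close>)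
qed

text \<open>Two facts are carried forward: the bound \<open>r\<close> on the range in an interval of
  directions, against which a boundary value can be recognised, and one singular member of the
  pencil, from which a singular value is read off.\<close>

lemma elliptic_arc_frontier_nilpotent:
  assumes X: "X \<in> carrier_mat N N"
    and nil: "\<And>x k. x \<in> carrier_vec N \<Longrightarrow> x \<noteq> 0\<^sub>v N \<Longrightarrow> X *\<^sub>v x = k \<cdot>\<^sub>v x \<Longrightarrow> k = 0"
    and zero: "0 \<in> numerical_range X"
    and arc: "elliptic_arc S" "S \<subseteq> frontier (numerical_range X)"
  obtains r \<alpha> \<beta> where "r > 0" "\<alpha> < \<beta>"
    "\<And>\<theta> w. \<alpha> < \<theta> \<Longrightarrow> \<theta> < \<beta> \<Longrightarrow> w \<in> numerical_range X \<Longrightarrow> Re (cis (- \<theta>) * w) \<le> r"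
    "\<exists>x\<in>carrier_vec N. x \<noteq> 0\<^sub>v N \<and>
       X *\<^sub>v x + of_real (4 * r\<^sup>2) \<cdot>\<^sub>v (conj_transpose X *\<^sub>v x) = of_real (- 4 * r\<^sup>2) \<cdot>\<^sub>v x"
proof -
  let ?W = "numerical_range X"
  obtain z0 t a b \<alpha> \<beta> where ab: "a > 0" "b > 0" and I: "\<alpha> < \<beta>"
    and normal: "\<forall>\<phi>. \<alpha> < \<phi> \<longrightarrow> \<phi> < \<beta> \<longrightarrow> (\<exists>k::real. k \<noteq> 0 \<and> (\<forall>w\<in>numerical_range X.
        Re (cnj (of_real k * (cis t * Complex (b * cos \<phi>) (a * sin \<phi>))) * w) \<le>
        Re (cnj (of_real k * (cis t * Complex (b * cos \<phi>) (a * sin \<phi>))) * ellipse_point z0 t a b \<phi>)))"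
    and pencil: "\<forall>z. \<exists>x\<in>carrier_vec N. x \<noteq> 0\<^sub>v N \<and>
      (cis (- t) * (of_real ((a + b) / 2) + of_real ((b - a) / 2) * z\<^sup>2)) \<cdot>\<^sub>v (X *\<^sub>v x) +
      (cis t * (of_real ((a + b) / 2) * z\<^sup>2 + of_real ((b - a) / 2))) \<cdot>\<^sub>v (conj_transpose X *\<^sub>v x) =
      (2 * of_real (a * b) * z + cis (- t) * (of_real ((a + b) / 2) + of_real ((b - a) / 2) * z\<^sup>2) * z0
        + cis t * (of_real ((a + b) / 2) * z\<^sup>2 + of_real ((b - a) / 2)) * cnj z0) \<cdot>\<^sub>v x"
    by (rule elliptic_arc_frontier_imp_pencil[OF X arc], rule that)
  define P Q :: complex where "P = of_real ((a + b) / 2)" and "Q = of_real ((b - a) / 2)"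
  have P0: "P \<noteq> 0" using ab by (simp add: P_def del: of_real_add of_real_divide)
  \<comment> \<open>When the coefficient of the adjoint vanishes, nilpotency kills the scalar term.\<close>
  have root: "2 * of_real (a * b) * z + cis (- t) * (P + Q * z\<^sup>2) * z0 = 0"
    if z: "P * z\<^sup>2 + Q = 0" and nz: "P + Q * z\<^sup>2 \<noteq> 0" for z
  proof -
    define B C where "B = cis (- t) * (P + Q * z\<^sup>2)" and "C = 2 * of_real (a * b) * z + B * z0"
    have "B \<noteq> 0" using nz by (simp add: B_def)
    obtain x where x: "x \<in> carrier_vec N" "x \<noteq> 0\<^sub>v N"
      "B \<cdot>\<^sub>v (X *\<^sub>v x) + 0 \<cdot>\<^sub>v (conj_transpose X *\<^sub>v x) = C \<cdot>\<^sub>v x"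
      using pencil[rule_format, of z, folded P_def Q_def] unfolding z B_def C_def by auto
    have c: "X *\<^sub>v x \<in> carrier_vec N" "conj_transpose X *\<^sub>v x \<in> carrier_vec N"
      using X x by (auto intro!: mult_mat_vec_carrier[of _ N N])
    have "(1 / B) \<cdot>\<^sub>v (B \<cdot>\<^sub>v (X *\<^sub>v x)) = (1 / B) \<cdot>\<^sub>v (C \<cdot>\<^sub>v x)"
    proof -
      have "B \<cdot>\<^sub>v (X *\<^sub>v x) = B \<cdot>\<^sub>v (X *\<^sub>v x) + 0 \<cdot>\<^sub>v (conj_transpose X *\<^sub>v x)"
        using c X by (intro eq_vecI) (auto simp: conj_transpose_def)
      then show ?thesis unfolding x(3) by simp
    qed
    then have "X *\<^sub>v x = (C / B) \<cdot>\<^sub>v x" using \<open>B \<noteq> 0\<close> by (simp add: smult_smult_assoc)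
    then have "C / B = 0" using nil x by blast
    then show ?thesis using \<open>B \<noteq> 0\<close> by (simp add: C_def B_def)
  qed
  have ab_eq: "a = b"
  proof (rule ccontr)
    assume "a \<noteq> b"
    then have Q0: "Q \<noteq> 0" by (simp add: Q_def del: of_real_diff of_real_divide)
    \<comment> \<open>For unequal axes the adjoint coefficient has two opposite nonzero roots. The
      relation \<open>root\<close> at \<open>z\<close> and at \<open>- z\<close> differs only in the
      sign of its first term, so subtracting the two gives z = 0, a contradiction.\<close>
    define z where "z = csqrt (- Q / P)"
    have z2: "z\<^sup>2 = - Q / P" by (simp add: z_def)
    have z0: "z \<noteq> 0" using Q0 P0 by (simp add: z_def)
    \<comment> \<open>The coefficient of \<open>X\<close> must survive at the root; it does because
      P^2 - Q^2 = a b.\<close>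
    have "P + Q * z\<^sup>2 = of_real (a * b) / P"
    proof -
      have "P * P - Q * Q = of_real (a * b)"
        by (simp add: P_def Q_def flip: of_real_mult of_real_diff of_real_add) (simp add: field_simps)
      then show ?thesis using P0 by (simp add: z2 field_simps)
    qed
    then have nz: "P + Q * z\<^sup>2 \<noteq> 0" using ab P0 by simp
    have e: "P * z\<^sup>2 + Q = 0" using P0 by (simp add: z2)
    have "2 * of_real (a * b) * z + cis (- t) * (P + Q * z\<^sup>2) * z0 = 0" using root[OF e nz] .
    moreover have "2 * of_real (a * b) * (- z) + cis (- t) * (P + Q * z\<^sup>2) * z0 = 0"
      using root[of "- z"] e nz by simp
    moreover have "u = 0" if "2 * u + d = 0" "2 * (- u) + d = 0" for u d :: complex
    proof -
      have "4 * u = (2 * u + d) - (2 * (- u) + d)" by simp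
      then show "u = 0" unfolding that by simp
    qed
    ultimately have "of_real (a * b) * z = 0"
      by (simp only: mult.assoc mult_minus_right)
    then show False using ab z0 by simp
  qed
  then have PQ: "P = of_real a" "Q = 0" by (simp_all add: P_def Q_def)
  \<comment> \<open>For equal axes the root is 0, and the relation there reduces to a nonzero
    multiple of the centre.\<close>
  have z0: "z0 = 0" using root[of 0] P0 PQ by simp
  show ?thesis
  proof (rule that[of a "t + \<alpha>" "t + \<beta>"])
    show "a > 0" "t + \<alpha> < t + \<beta>" using ab I by simp_all
  next
    fix \<theta> w assume th: "t + \<alpha> < \<theta>" "\<theta> < t + \<beta>" and w: "w \<in> ?W"
    define \<phi> where "\<phi> = \<theta> - t"
    have n: "cis t * Complex (b * cos \<phi>) (a * sin \<phi>) = of_real a * cis \<theta>"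
    proof -
      have "Complex (b * cos \<phi>) (a * sin \<phi>) = of_real a * cis \<phi>"
        by (simp add: complex_eq_iff ab_eq)
      then have "cis t * Complex (b * cos \<phi>) (a * sin \<phi>) = of_real a * (cis t * cis \<phi>)" by simp
      also have "cis t * cis \<phi> = cis \<theta>" by (simp add: cis_mult \<phi>_def)
      finally show ?thesis .
    qed
    then have p: "ellipse_point z0 t a b \<phi> = of_real a * cis \<theta>"
      unfolding ellipse_point_def z0 using ab_eq by simp
    obtain k :: real where k: "k \<noteq> 0" "\<forall>w\<in>?W. Re (cnj (of_real k * (of_real a * cis \<theta>)) * w) \<le>
        Re (cnj (of_real k * (of_real a * cis \<theta>)) * (of_real a * cis \<theta>))"
      using normal[rule_format, of \<phi>] th unfolding n p by (auto simp: \<phi>_def)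
    have *: "Re (cnj (of_real k * (of_real a * cis \<theta>)) * w) = k * a * Re (cis (- \<theta>) * w)" for w
    proof -
      have "cnj (of_real k * (of_real a * cis \<theta>)) * w = of_real (k * a) * (cis (- \<theta>) * w)"
        by (simp add: cis_cnj)
      then show ?thesis by (simp only: times_complex.sel Re_complex_of_real Im_complex_of_real)
    qed
    have "cis (- \<theta>) * (of_real a * cis \<theta>) = of_real a * (cis (- \<theta>) * cis \<theta>)" by simp
    also have "cis (- \<theta>) * cis \<theta> = 1" by (simp add: cis_mult)
    finally have aa: "Re (cis (- \<theta>) * (of_real a * cis \<theta>)) = a"
      by (simp only: mult_1_right Re_complex_of_real)
    have le: "k * a * Re (cis (- \<theta>) * w) \<le> k * a * a" if "w \<in> ?W" for w
      using k(2) that unfolding * aa by blast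
    \<comment> \<open>The sign left open in the normal: applying the supporting inequality to the
      point 0 of the range makes \<open>k\<close> positive.\<close>
    have "0 \<le> k * a * a" using le[OF zero] by simp
    then have "k > 0" using k(1) ab by (simp add: zero_le_mult_iff)
    then show "Re (cis (- \<theta>) * w) \<le> a" using le[OF w] ab by simp
  next
    \<comment> \<open>In zeta = \<open>cis t * z\<close> the pencil reads X + zeta^2 X^H = 2 a zeta
      I after division by \<open>cis (- t) * of_real a\<close>; the factor \<open>e\<close> below
      performs that division, and the choice is zeta = -2 a.\<close>
    define z where "z = - 2 * of_real a * cis (- t)"
    have tt: "cis t * cis (- t) = 1" by (simp add: cis_mult)
    have g: "cis t * z\<^sup>2 = 4 * of_real (a\<^sup>2) * cis (- t)"
    proof -
      have "cis t * z\<^sup>2 = 4 * of_real (a\<^sup>2) * cis (- t) * (cis t * cis (- t))"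
        by (simp add: z_def power2_eq_square)
      then show ?thesis unfolding tt by simp
    qed
    obtain x where x: "x \<in> carrier_vec N" "x \<noteq> 0\<^sub>v N"
      "(cis (- t) * of_real a) \<cdot>\<^sub>v (X *\<^sub>v x) + (of_real a * (cis t * z\<^sup>2)) \<cdot>\<^sub>v (conj_transpose X *\<^sub>v x) =
        (2 * of_real (a * b) * z) \<cdot>\<^sub>v x" (is "?L = ?R")
      using pencil[rule_format, of z, folded P_def Q_def] unfolding PQ z0 by (auto simp: mult_ac)
    have c: "X *\<^sub>v x \<in> carrier_vec N" "conj_transpose X *\<^sub>v x \<in> carrier_vec N"
      using X x by (auto intro!: mult_mat_vec_carrier[of _ N N])
    define e where "e = cis t / of_real a"
    have e: "e * (cis (- t) * of_real a) = 1" using ab tt by (simp add: e_def)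
    have 1: "e * (of_real a * (cis t * z\<^sup>2)) = of_real (4 * a\<^sup>2)"
      unfolding g using ab tt by (simp add: e_def mult_ac)
    have 2: "e * (2 * of_real (a * b) * z) = of_real (- 4 * a\<^sup>2)"
    proof -
      have ea: "e * of_real a = cis t" using ab by (simp add: e_def)
      have "e * (2 * of_real (a * b) * z) = 2 * (e * of_real a) * of_real b * z"
        by (simp only: of_real_mult mult_ac)
      also have "\<dots> = - 4 * of_real (a\<^sup>2) * (cis t * cis (- t))"
        unfolding ea z_def ab_eq[symmetric] power2_eq_square of_real_mult by (simp only: mult_ac) simp
      also have "\<dots> = of_real (- 4 * a\<^sup>2)" unfolding tt by simp
      finally show ?thesis .
    qed
    have "e \<cdot>\<^sub>v ?L = e \<cdot>\<^sub>v ?R" by (rule arg_cong[OF x(3)])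
    also have "e \<cdot>\<^sub>v ?L = X *\<^sub>v x + of_real (4 * a\<^sup>2) \<cdot>\<^sub>v (conj_transpose X *\<^sub>v x)"
    proof -
      have "k \<cdot>\<^sub>v (p \<cdot>\<^sub>v (X *\<^sub>v x) + q \<cdot>\<^sub>v (conj_transpose X *\<^sub>v x)) =
          (k * p) \<cdot>\<^sub>v (X *\<^sub>v x) + (k * q) \<cdot>\<^sub>v (conj_transpose X *\<^sub>v x)" for k p q
        using c by (simp add: smult_add_distrib_vec[of _ N] smult_smult_assoc)
      then show ?thesis by (simp only: e 1 one_smult_vec)
    qed
    also have "e \<cdot>\<^sub>v ?R = of_real (- 4 * a\<^sup>2) \<cdot>\<^sub>v x"
      by (simp only: smult_smult_assoc 2)
    finally show "\<exists>x\<in>carrier_vec N. x \<noteq> 0\<^sub>v N \<and>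
       X *\<^sub>v x + of_real (4 * a\<^sup>2) \<cdot>\<^sub>v (conj_transpose X *\<^sub>v x) = of_real (- 4 * a\<^sup>2) \<cdot>\<^sub>v x"
      using x by blast
  qed
qed

section \<open>Block structure of KMS matrices\<close>

definition vec_block :: "nat \<Rightarrow> nat \<Rightarrow> complex vec \<Rightarrow> complex vec" where
  "vec_block n i x = vec n (\<lambda>k. x $ (i * n + k))"

definition block_vec :: "nat \<Rightarrow> nat \<Rightarrow> (nat \<Rightarrow> complex vec) \<Rightarrow> complex vec" where
  "block_vec m n v = vec (m * n) (\<lambda>r. v (r div n) $ (r mod n))"

definition block_mat :: "nat \<Rightarrow> nat \<Rightarrow> (nat \<Rightarrow> nat \<Rightarrow> complex mat) \<Rightarrow> complex mat" where
  "block_mat m n F = mat (m * n) (m * n) (\<lambda>(r, c). F (r div n) (c div n) $$ (r mod n, c mod n))"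

lemma vec_block_carrier [simp]: "vec_block n i x \<in> carrier_vec n"
  by (simp add: vec_block_def)

lemma block_vec_carrier [simp]: "block_vec m n v \<in> carrier_vec (m * n)"
  by (simp add: block_vec_def)

lemma block_mat_carrier [simp]: "block_mat m n F \<in> carrier_mat (m * n) (m * n)"
  by (simp add: block_mat_def)

lemma block_index_less:
  assumes "i < m" "k < n"
  shows "i * n + k < m * (n :: nat)"
proof -
  have "i * n + k < Suc i * n" using assms by simp
  also have "\<dots> \<le> m * n" using assms by (intro mult_le_mono1) simp
  finally show ?thesis .
qed

lemma block_index_bounds:
  assumes "r < m * (n :: nat)"
  shows "r div n < m" "r mod n < n"
proof -
  have "n > 0" using assms by (cases n) auto
  then show "r mod n < n" by simp
  show "r div n < m" using assms \<open>n > 0\<close> by (simp add: less_mult_imp_div_less)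
qed

lemma sum_blocks:
  "(\<Sum>r<m * n. f r) = (\<Sum>i<m. \<Sum>k<n. f (i * n + k))" for f :: "nat \<Rightarrow> 'a :: comm_monoid_add"
proof -
  have "sum f {i * n..<i * n + n} = (\<Sum>k<n. f (i * n + k))" for i
    using sum.shift_bounds_nat_ivl[of f 0 "i * n" n] by (simp add: lessThan_atLeast0 add.commute)
  then show ?thesis by (simp flip: sum.nat_group)
qed

lemma vec_block_eqI:
  assumes x: "x \<in> carrier_vec (m * n)" and y: "y \<in> carrier_vec (m * n)"
    and eq: "\<And>i. i < m \<Longrightarrow> vec_block n i x = vec_block n i y"
  shows "x = y"
proof (rule eq_vecI)
  fix r assume "r < dim_vec y"
  then have r: "r < m * n" using y by simp
  note b = block_index_bounds[OF r]
  have "vec_block n (r div n) x $ (r mod n) = vec_block n (r div n) y $ (r mod n)"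
    using eq[OF b(1)] by simp
  then show "x $ r = y $ r" using b by (simp add: vec_block_def)
qed (use x y in simp)

lemma vec_block_zero [simp]: "i < m \<Longrightarrow> vec_block n i (0\<^sub>v (m * n)) = 0\<^sub>v n"
  by (intro eq_vecI) (auto simp: vec_block_def block_index_less)

lemma vec_block_add:
  assumes "x \<in> carrier_vec (m * n)" "y \<in> carrier_vec (m * n)" "i < m"
  shows "vec_block n i (x + y) = vec_block n i x + vec_block n i y"
  using assms by (intro eq_vecI) (auto simp: vec_block_def block_index_less)

lemma vec_block_smult:
  assumes "x \<in> carrier_vec (m * n)" "i < m"
  shows "vec_block n i (c \<cdot>\<^sub>v x) = c \<cdot>\<^sub>v vec_block n i x"
  using assms by (intro eq_vecI) (auto simp: vec_block_def block_index_less)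

lemma vec_block_block_vec:
  assumes "v i \<in> carrier_vec n" "i < m"
  shows "vec_block n i (block_vec m n v) = v i"
  using assms by (intro eq_vecI) (auto simp: vec_block_def block_vec_def block_index_less)

lemma cscalar_prod_blocks:
  assumes x: "x \<in> carrier_vec (m * n)" and y: "y \<in> carrier_vec (m * n)"
  shows "x \<bullet>c y = (\<Sum>i<m. vec_block n i x \<bullet>c vec_block n i y)"
  unfolding cscalar_prod_sum[OF y] sum_blocks cscalar_prod_sum[OF vec_block_carrier]
  by (simp add: vec_block_def)

lemma block_mat_mult_vec:
  assumes F: "\<And>i l. F i l \<in> carrier_mat n n" and x: "x \<in> carrier_vec (m * n)" and i: "i < m" and k: "k < n"
  shows "vec_block n i (block_mat m n F *\<^sub>v x) $ k = (\<Sum>l<m. (F i l *\<^sub>v vec_block n l x) $ k)"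
proof -
  have "vec_block n i (block_mat m n F *\<^sub>v x) $ k = (block_mat m n F *\<^sub>v x) $ (i * n + k)"
    using k by (simp add: vec_block_def)
  also have "\<dots> = (\<Sum>l<m. \<Sum>j<n. block_mat m n F $$ (i * n + k, l * n + j) * x $ (l * n + j))"
    unfolding mult_mat_vec_sum[OF block_mat_carrier x block_index_less[OF i k]] sum_blocks ..
  also have "\<dots> = (\<Sum>l<m. (F i l *\<^sub>v vec_block n l x) $ k)"
    unfolding mult_mat_vec_sum[OF F vec_block_carrier k]
    using i k by (intro sum.cong refl) (simp add: block_mat_def vec_block_def block_index_less)
  finally show ?thesis .
qed

lemma conj_transpose_block_mat:
  assumes "\<And>i l. F i l \<in> carrier_mat n n"
  shows "conj_transpose (block_mat m n F) = block_mat m n (\<lambda>i l. conj_transpose (F l i))"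
proof (rule eq_matI)
  fix r c assume "r < dim_row (block_mat m n (\<lambda>i l. conj_transpose (F l i)))"
    "c < dim_col (block_mat m n (\<lambda>i l. conj_transpose (F l i)))"
  then have r: "r < m * n" "c < m * n" by (simp_all add: block_mat_def)
  show "conj_transpose (block_mat m n F) $$ (r, c) = block_mat m n (\<lambda>i l. conj_transpose (F l i)) $$ (r, c)"
    using r block_index_bounds[OF r(1)] block_index_bounds[OF r(2)] assms[of "c div n" "r div n"]
    by (auto simp: conj_transpose_def block_mat_def)
qed (simp_all add: conj_transpose_def block_mat_def)

section \<open>Block recursions for the KMS matrix and its adjoint\<close>

definition kms_block :: "nat \<Rightarrow> complex mat \<Rightarrow> nat \<Rightarrow> nat \<Rightarrow> complex mat" where
  "kms_block n A i l = (if i < l then A ^\<^sub>m (l - i) else 0\<^sub>m n n)"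

lemma kms_block_carrier [simp]: "A \<in> carrier_mat n n \<Longrightarrow> kms_block n A i l \<in> carrier_mat n n"
  by (simp add: kms_block_def)

lemma KMS_matrix_eq_block_mat:
  assumes "A \<in> carrier_mat n n"
  shows "KMS_matrix m A = block_mat m n (kms_block n A)"
  using assms
  by (intro eq_matI) (auto simp: KMS_matrix_def block_mat_def kms_block_def Let_def block_index_bounds)

lemma KMS_matrix_carrier:
  "A \<in> carrier_mat n n \<Longrightarrow> KMS_matrix m A \<in> carrier_mat (m * n) (m * n)"
  by (simp add: KMS_matrix_eq_block_mat)

lemma mult_pow_mat:
  fixes A :: "'a :: semiring_1 mat"
  assumes "A \<in> carrier_mat n n"
  shows "A * A ^\<^sub>m k = A ^\<^sub>m Suc k"
proof (induction k)
  case (Suc k)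
  have "A * A ^\<^sub>m Suc k = (A * A ^\<^sub>m k) * A"
    using assms by (simp add: assoc_mult_mat[of _ n n _ n _ n])
  then show ?case using Suc by simp
qed (use assms in simp)

lemma sum_mult_mat_vec_index:
  fixes M :: "complex mat"
  assumes M: "M \<in> carrier_mat n n" and w: "w \<in> carrier_vec n" and v: "\<And>l. l < m \<Longrightarrow> v l \<in> carrier_vec n"
    and wv: "\<And>j. j < n \<Longrightarrow> w $ j = (\<Sum>l<m. v l $ j)" and k: "k < n"
  shows "(M *\<^sub>v w) $ k = (\<Sum>l<m. (M *\<^sub>v v l) $ k)"
proof -
  have "(M *\<^sub>v w) $ k = (\<Sum>j<n. \<Sum>l<m. M $$ (k, j) * v l $ j)"
    unfolding mult_mat_vec_sum[OF M w k] by (intro sum.cong refl) (simp add: wv sum_distrib_left)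
  also have "\<dots> = (\<Sum>l<m. \<Sum>j<n. M $$ (k, j) * v l $ j)" by (rule sum.swap)
  also have "\<dots> = (\<Sum>l<m. (M *\<^sub>v v l) $ k)"
    by (intro sum.cong refl) (use v in \<open>simp add: mult_mat_vec_sum[OF M _ k] del: index_mult_mat_vec\<close>)
  finally show ?thesis .
qed

text \<open>With \<open>B\<close> the block shift whose superdiagonal blocks are \<open>A\<close>, one has \<open>K = B (I + K)\<close>;
  blockwise this is a recursion from the last block upwards.\<close>

lemma vec_block_KMS_matrix:
  assumes A: "A \<in> carrier_mat n n" and x: "x \<in> carrier_vec (m * n)"
  defines "u \<equiv> KMS_matrix m A *\<^sub>v x"
  shows "Suc i < m \<Longrightarrow> vec_block n i u = A *\<^sub>v (vec_block n (Suc i) x + vec_block n (Suc i) u)"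
    and "Suc i = m \<Longrightarrow> vec_block n i u = 0\<^sub>v n"
proof -
  have u: "vec_block n i u $ k = (\<Sum>l<m. (kms_block n A i l *\<^sub>v vec_block n l x) $ k)"
    if "i < m" "k < n" for i k
    unfolding u_def KMS_matrix_eq_block_mat[OF A]
    by (rule block_mat_mult_vec) (use A x that in auto)
  have z: "(0\<^sub>m n n *\<^sub>v vec_block n l x) $ k = 0" if "k < n" for l k
    using that by (subst mult_mat_vec_sum[of _ n n]) auto
  show "vec_block n i u = 0\<^sub>v n" if "Suc i = m"
  proof (rule eq_vecI)
    fix k assume "k < dim_vec (0\<^sub>v n :: complex vec)"
    then show "vec_block n i u $ k = 0\<^sub>v n $ k"
      using that by (simp add: u kms_block_def z del: index_mult_mat_vec)
  qed (simp add: vec_block_def)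
  show "vec_block n i u = A *\<^sub>v (vec_block n (Suc i) x + vec_block n (Suc i) u)" if i: "Suc i < m"
  proof (rule eq_vecI)
    fix k assume "k < dim_vec (A *\<^sub>v (vec_block n (Suc i) x + vec_block n (Suc i) u))"
    then have k: "k < n" using A by simp
    \<comment> \<open>\<open>G l\<close> is the block of I + K in row \<open>Suc i\<close> and
      column \<open>l\<close>. Multiplying it by \<open>A\<close> raises the power by one and gives
      the block of K in row \<open>i\<close>.\<close>
    define G where "G l = (if l = Suc i then 1\<^sub>m n else kms_block n A (Suc i) l)" for l
    have G: "G l \<in> carrier_mat n n" for l using A by (simp add: G_def)
    have AG: "A * G l = kms_block n A i l" for l
    proof -
      consider "l = Suc i" | "Suc i < l" | "l \<le> i" by linarith
      then show ?thesis
      proof cases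
        case 2
        then have "Suc (l - Suc i) = l - i" by simp
        then show ?thesis using 2 mult_pow_mat[OF A, of "l - Suc i"] by (simp add: G_def kms_block_def)
      qed (use A in \<open>auto simp: G_def kms_block_def\<close>)
    qed
    have "(A *\<^sub>v (vec_block n (Suc i) x + vec_block n (Suc i) u)) $ k
        = (\<Sum>l<m. (A *\<^sub>v (G l *\<^sub>v vec_block n l x)) $ k)"
    proof (rule sum_mult_mat_vec_index[OF A _ _ _ k])
      fix j assume j: "j < n"
      have "(G l *\<^sub>v vec_block n l x) $ j =
          (if l = Suc i then vec_block n l x $ j else 0) + (kms_block n A (Suc i) l *\<^sub>v vec_block n l x) $ j" for l
        using j by (simp add: G_def kms_block_def z del: index_mult_mat_vec)
      then show "(vec_block n (Suc i) x + vec_block n (Suc i) u) $ j = (\<Sum>l<m. (G l *\<^sub>v vec_block n l x) $ j)"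
        using i j by (simp add: sum.distrib u vec_block_carrier[THEN carrier_vecD] del: index_mult_mat_vec)
    qed (use G in \<open>auto intro!: mult_mat_vec_carrier[of _ n n]\<close>)
    also have "\<dots> = vec_block n i u $ k"
      using assoc_mult_mat_vec[OF A G vec_block_carrier] i k
      by (simp add: u AG[symmetric] del: index_mult_mat_vec assoc_mult_mat_vec)
    finally show "vec_block n i u $ k = (A *\<^sub>v (vec_block n (Suc i) x + vec_block n (Suc i) u)) $ k" ..
  qed (use A in \<open>simp add: vec_block_def\<close>)
qed

lemma conj_transpose_mult:
  assumes "A \<in> carrier_mat n n" "B \<in> carrier_mat n n"
  shows "conj_transpose (A * B) = conj_transpose B * conj_transpose A"
  using assms by (intro eq_matI) (auto simp: conj_transpose_def scalar_prod_def mult.commute intro!: sum.cong)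

lemma conj_transpose_zero [simp]: "conj_transpose (0\<^sub>m n n) = 0\<^sub>m n n"
  by (intro eq_matI) (auto simp: conj_transpose_def)

text \<open>The block shift B commutes with K, so also K = (I + K) B. Taking adjoints gives K^H =
  B^H (I + K^H), and since B^H moves blocks down, the recursion starts from block 0 and runs
  downwards.\<close>

lemma vec_block_conj_transpose_KMS_matrix:
  assumes A: "A \<in> carrier_mat n n" and x: "x \<in> carrier_vec (m * n)"
  defines "g \<equiv> conj_transpose (KMS_matrix m A) *\<^sub>v x"
  shows "Suc i < m \<Longrightarrow> vec_block n (Suc i) g = conj_transpose A *\<^sub>v (vec_block n i x + vec_block n i g)"
    and "0 < m \<Longrightarrow> vec_block n 0 g = 0\<^sub>v n"
proof -
  let ?H = "conj_transpose A"
  have H: "?H \<in> carrier_mat n n" using A by simp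
  define F where "F i l = conj_transpose (kms_block n A l i)" for i l
  have F: "F i l \<in> carrier_mat n n" for i l using A by (simp add: F_def)
  have u: "vec_block n i g $ k = (\<Sum>l<m. (F i l *\<^sub>v vec_block n l x) $ k)"
    if "i < m" "k < n" for i k
    unfolding g_def KMS_matrix_eq_block_mat[OF A] conj_transpose_block_mat[OF kms_block_carrier[OF A]] F_def
    by (rule block_mat_mult_vec) (use A x that in auto)
  have z: "(0\<^sub>m n n *\<^sub>v vec_block n l x) $ k = 0" if "k < n" for l k
    using that by (subst mult_mat_vec_sum[of _ n n]) auto
  show "vec_block n 0 g = 0\<^sub>v n" if "0 < m"
  proof (rule eq_vecI)
    fix k assume "k < dim_vec (0\<^sub>v n :: complex vec)"
    then show "vec_block n 0 g $ k = 0\<^sub>v n $ k"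
      using that by (simp add: u F_def kms_block_def z del: index_mult_mat_vec)
  qed (simp add: vec_block_def)
  show "vec_block n (Suc i) g = ?H *\<^sub>v (vec_block n i x + vec_block n i g)" if i: "Suc i < m"
  proof (rule eq_vecI)
    fix k assume "k < dim_vec (?H *\<^sub>v (vec_block n i x + vec_block n i g))"
    then have k: "k < n" using H by simp
    define G where "G l = (if l = i then 1\<^sub>m n else F i l)" for l
    have G: "G l \<in> carrier_mat n n" for l using F by (simp add: G_def)
    have HG: "?H * G l = F (Suc i) l" for l
    proof -
      consider "l = i" | "l < i" | "i < l" by linarith
      then show ?thesis
      proof cases
        case 2
        have "F (Suc i) l = conj_transpose (A ^\<^sub>m (i - l) * A)"
          using 2 by (simp add: F_def kms_block_def Suc_diff_le)
        also have "\<dots> = ?H * F i l"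
          using 2 A by (simp add: F_def kms_block_def conj_transpose_mult[of _ n])
        finally show ?thesis using 2 by (simp add: G_def)
      qed (use A H in \<open>auto simp: G_def F_def kms_block_def right_mult_one_mat[OF H] right_mult_zero_mat[OF H]\<close>)
    qed
    have "(?H *\<^sub>v (vec_block n i x + vec_block n i g)) $ k
        = (\<Sum>l<m. (?H *\<^sub>v (G l *\<^sub>v vec_block n l x)) $ k)"
    proof (rule sum_mult_mat_vec_index[OF H _ _ _ k])
      fix j assume j: "j < n"
      have "(G l *\<^sub>v vec_block n l x) $ j =
          (if l = i then vec_block n l x $ j else 0) + (F i l *\<^sub>v vec_block n l x) $ j" for l
        using j by (simp add: G_def F_def kms_block_def z del: index_mult_mat_vec)
      then show "(vec_block n i x + vec_block n i g) $ j = (\<Sum>l<m. (G l *\<^sub>v vec_block n l x) $ j)"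
        using i j by (simp add: sum.distrib u vec_block_carrier[THEN carrier_vecD] del: index_mult_mat_vec)
    qed (use G in \<open>auto intro!: mult_mat_vec_carrier[of _ n n]\<close>)
    also have "\<dots> = vec_block n (Suc i) g $ k"
      using assoc_mult_mat_vec[OF H G vec_block_carrier] i k
      by (simp add: u HG[symmetric] del: index_mult_mat_vec assoc_mult_mat_vec)
    finally show "vec_block n (Suc i) g $ k = (?H *\<^sub>v (vec_block n i x + vec_block n i g)) $ k" ..
  qed (use H in \<open>simp add: vec_block_def\<close>)
qed

text \<open>K is strictly block upper triangular, so it annihilates a unit vector supported in the
  first block.\<close>

lemma zero_mem_numerical_range_KMS_matrix:
  assumes A: "A \<in> carrier_mat n n" and m: "m \<ge> 1" and n: "n \<ge> 1"
  shows "0 \<in> numerical_range (KMS_matrix m A)"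
proof -
  define x where "x = block_vec m n (\<lambda>i. if i = 0 then unit_vec n 0 else 0\<^sub>v n)"
  have x: "x \<in> carrier_vec (m * n)" by (simp add: x_def)
  have xi: "vec_block n i x = (if i = 0 then unit_vec n 0 else 0\<^sub>v n)" if "i < m" for i
    unfolding x_def using that by (subst vec_block_block_vec) auto
  define u where "u = KMS_matrix m A *\<^sub>v x"
  have u: "u \<in> carrier_vec (m * n)"
    using KMS_matrix_carrier[OF A, of m] x by (auto simp: u_def intro!: mult_mat_vec_carrier[of _ "m * n" "m * n"])
  have ui: "vec_block n i u = 0\<^sub>v n" if "i < m" for i
    using that
  \<comment> \<open>Induction on the distance to the end runs the recursion from the last block
    upwards; its base case is vacuous.\<close>
  proof (induction "m - i" arbitrary: i)
    case (Suc d)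
    show ?case
    proof (cases "Suc i = m")
      case True
      then show ?thesis unfolding u_def by (rule vec_block_KMS_matrix(2)[OF A x])
    next
      case False
      then have i: "Suc i < m" using Suc by simp
      have "vec_block n (Suc i) u = 0\<^sub>v n" using Suc(1)[of "Suc i"] Suc(2) i by simp
      then show ?thesis
        using vec_block_KMS_matrix(1)[OF A x i, folded u_def] xi[OF i] A by simp
    qed
  qed simp
  have "u \<bullet>c x = 0" unfolding cscalar_prod_blocks[OF u x] by (simp add: ui)
  moreover have "x \<bullet>c x = 1"
  proof -
    have "x \<bullet>c x = (\<Sum>i<m. if i = 0 then 1 else 0)"
      unfolding cscalar_prod_blocks[OF x x]
      by (intro sum.cong refl) (use n in \<open>auto simp: xi\<close>)
    then show ?thesis using m by simp
  qed
  ultimately show ?thesis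
    unfolding numerical_range_iff[OF KMS_matrix_carrier[OF A]] using x u_def by auto
qed

text \<open>Nilpotency in the form needed for the pencil. The last block of K x is zero; for nonzero
  \<open>k\<close> the same block of \<open>x\<close> vanishes, and the recursion passes this up
  block by block until \<open>x\<close> is zero.\<close>

lemma KMS_matrix_eigenvalue_zero:
  assumes A: "A \<in> carrier_mat n n" and x: "x \<in> carrier_vec (m * n)" "x \<noteq> 0\<^sub>v (m * n)"
    and ev: "KMS_matrix m A *\<^sub>v x = k \<cdot>\<^sub>v x"
  shows "k = 0"
proof (rule ccontr)
  assume k: "k \<noteq> 0"
  define u where "u = KMS_matrix m A *\<^sub>v x"
  have ux: "vec_block n i u = k \<cdot>\<^sub>v vec_block n i x" if "i < m" for i
    unfolding u_def ev using x(1) that by (rule vec_block_smult)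
  have xi: "vec_block n i x = 0\<^sub>v n" if "vec_block n i u = 0\<^sub>v n" "i < m" for i
  proof -
    have "(1 / k) \<cdot>\<^sub>v (k \<cdot>\<^sub>v vec_block n i x) = 0\<^sub>v n" using ux that by simp
    then show ?thesis using k by (simp add: smult_smult_assoc)
  qed
  have "vec_block n i u = 0\<^sub>v n" if "i < m" for i
    using that
  proof (induction "m - i" arbitrary: i)
    case (Suc d)
    show ?case
    proof (cases "Suc i = m")
      case True
      then show ?thesis unfolding u_def by (rule vec_block_KMS_matrix(2)[OF A x(1)])
    next
      case False
      then have i: "Suc i < m" using Suc by simp
      have "vec_block n (Suc i) u = 0\<^sub>v n" using Suc(1)[of "Suc i"] Suc(2) i by simp
      then show ?thesis
        using vec_block_KMS_matrix(1)[OF A x(1) i, folded u_def] xi[OF _ i] A by simp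
    qed
  qed simp
  then have "x = 0\<^sub>v (m * n)" using x(1) xi by - (rule vec_block_eqI[of x m n], auto)
  then show False using x(2) by simp
qed

text \<open>Put \<open>y = x + K x\<close>. The block recursions for \<open>K\<close> and its adjoint turn the equation into
  \<open>A* A y\<^sub>j = s\<^sup>2 y\<^sub>j + (1 - s\<^sup>2) A y\<^sub>j\<^sub>+\<^sub>1\<close> for \<open>j \<ge> 1\<close>; the last nonzero block is the vector sought.\<close>

lemma KMS_matrix_pencil_singular_value:
  fixes s :: real
  assumes A: "A \<in> carrier_mat n n" and s: "s > 0"
    and x: "x \<in> carrier_vec (m * n)" "x \<noteq> 0\<^sub>v (m * n)"
    and eq: "KMS_matrix m A *\<^sub>v x + of_real (s\<^sup>2) \<cdot>\<^sub>v (conj_transpose (KMS_matrix m A) *\<^sub>v x) = of_real (- s\<^sup>2) \<cdot>\<^sub>v x"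
  obtains v where "v \<in> carrier_vec n" "v \<noteq> 0\<^sub>v n"
    "conj_transpose A *\<^sub>v (A *\<^sub>v v) = of_real (s\<^sup>2) \<cdot>\<^sub>v v"
proof -
  let ?K = "KMS_matrix m A" and ?H = "conj_transpose A"
  define S where "S = complex_of_real (s\<^sup>2)"
  have S: "S \<noteq> 0" using s by (simp add: S_def)
  have K: "?K \<in> carrier_mat (m * n) (m * n)" by (rule KMS_matrix_carrier[OF A])
  have H: "?H \<in> carrier_mat n n" using A by simp
  define u g where "u = ?K *\<^sub>v x" and "g = conj_transpose ?K *\<^sub>v x"
  have c: "u \<in> carrier_vec (m * n)" "g \<in> carrier_vec (m * n)"
    unfolding u_def g_def using K x by (auto intro!: mult_mat_vec_carrier[of _ "m * n" "m * n"])
  define X U G where "X i = vec_block n i x" and "U i = vec_block n i u" and "G i = vec_block n i g" for i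
  have cc: "X i \<in> carrier_vec n" "U i \<in> carrier_vec n" "G i \<in> carrier_vec n" for i
    by (simp_all add: X_def U_def G_def)
  note U = vec_block_KMS_matrix[OF A x(1), folded u_def, folded U_def X_def]
  note G = vec_block_conj_transpose_KMS_matrix[OF A x(1), folded g_def, folded G_def X_def]
  have E: "U i + S \<cdot>\<^sub>v G i = (- S) \<cdot>\<^sub>v X i" if "i < m" for i
  proof -
    have "vec_block n i (u + S \<cdot>\<^sub>v g) = vec_block n i ((- S) \<cdot>\<^sub>v x)"
      using eq by (simp add: u_def g_def S_def)
    then show ?thesis
      using c x(1) that by (simp add: vec_block_add[of _ m] vec_block_smult[of _ m] U_def G_def X_def)
  qed
  have E': "S * (X i $ k + G i $ k) = - (U i $ k)" if "i < m" "k < n" for i k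
  proof -
    have "(U i + S \<cdot>\<^sub>v G i) $ k = ((- S) \<cdot>\<^sub>v X i) $ k" using E[OF that(1)] by simp
    then have "U i $ k + S * G i $ k = - (S * X i $ k)"
      using that cc[of i, THEN carrier_vecD] by simp
    then show ?thesis by (simp add: distrib_left eq_neg_iff_add_eq_0 add.commute add.left_commute)
  qed
  define Y where "Y i = X i + U i" for i
  have Y: "Y i \<in> carrier_vec n" for i using cc by (simp add: Y_def)
  have UY: "U i = A *\<^sub>v Y (Suc i)" if "Suc i < m" for i using U(1)[OF that] by (simp add: Y_def)
  \<comment> \<open>Block 0 must be left out because the adjoint recursion needs a predecessor. If
    all later \<open>Y j\<close> vanished, K x would be zero, and then block 0 of the equation,
    where the adjoint term is zero as well, would give \<open>x = 0\<close>.\<close>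
  have "\<exists>j. 1 \<le> j \<and> j < m \<and> Y j \<noteq> 0\<^sub>v n"
  proof (rule ccontr)
    assume "\<not> ?thesis"
    then have Y0: "Y j = 0\<^sub>v n" if "1 \<le> j" "j < m" for j using that by blast
    have U0: "U i = 0\<^sub>v n" if "i < m" for i
    proof (cases "Suc i < m")
      case True
      then show ?thesis using UY Y0[of "Suc i"] A by simp
    next
      case False
      then show ?thesis using U(2)[of i] that by simp
    qed
    have "X i = 0\<^sub>v n" if i: "i < m" for i
    proof (cases "i = 0")
      case True
      then have G0: "G i = 0\<^sub>v n" using G(2) i by simp
      show ?thesis
        using E'[OF i] cc(1)[of i] S G0 U0[OF i] by (intro eq_vecI) auto
    next
      case False
      then show ?thesis using Y0[of i] U0[OF i] i cc(1)[of i] by (simp add: Y_def)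
    qed
    then have "x = 0\<^sub>v (m * n)" using x(1) by - (rule vec_block_eqI[of x m n], auto simp: X_def)
    then show False using x(2) by simp
  qed
  then have fin: "finite {j. 1 \<le> j \<and> j < m \<and> Y j \<noteq> 0\<^sub>v n}" "{j. 1 \<le> j \<and> j < m \<and> Y j \<noteq> 0\<^sub>v n} \<noteq> {}"
    by auto
  \<comment> \<open>Taking the last nonzero block makes U j = A y_(j+1) vanish, so that the term
    with factor 1 - s^2 disappears.\<close>
  define j where "j = Max {j. 1 \<le> j \<and> j < m \<and> Y j \<noteq> 0\<^sub>v n}"
  have j: "1 \<le> j" "j < m" "Y j \<noteq> 0\<^sub>v n" using Max_in[OF fin] by (auto simp: j_def)
  have Uj: "U j = 0\<^sub>v n"
  proof (cases "Suc j < m")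
    case True
    have "Y (Suc j) = 0\<^sub>v n"
    proof (rule ccontr)
      assume "Y (Suc j) \<noteq> 0\<^sub>v n"
      then have "Suc j \<le> j" unfolding j_def by (intro Max_ge fin(1)) (use True in \<open>simp add: j_def\<close>)
      then show False by simp
    qed
    then show ?thesis using UY[OF True] A by simp
  next
    case False
    then show ?thesis using U(2)[of j] j by simp
  qed
  obtain i where ji: "j = Suc i" using j(1) by (cases j) auto
  have i: "i < m" "Suc i < m" using j ji by simp_all
  have UiY: "U i = A *\<^sub>v Y j" using UY[of i] i ji by simp
  have Yj: "Y j = X j" using cc(1)[of j] Uj by (simp add: Y_def)
  \<comment> \<open>The equation in block \<open>i\<close> trades the argument
    \<open>X i + G i\<close> of the adjoint recursion for \<open>U i\<close>, which is A
    y_j.\<close>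
  have "S \<cdot>\<^sub>v (X i + G i) = (- 1) \<cdot>\<^sub>v U i"
  proof (rule eq_vecI)
    fix k assume "k < dim_vec ((- 1) \<cdot>\<^sub>v U i)"
    then have "k < n" using cc(2)[of i] by simp
    then show "(S \<cdot>\<^sub>v (X i + G i)) $ k = ((- 1) \<cdot>\<^sub>v U i) $ k"
      using E'[OF i(1)] cc[of i, THEN carrier_vecD] by simp
  qed (use cc[of i, THEN carrier_vecD] in simp)
  then have "?H *\<^sub>v (S \<cdot>\<^sub>v (X i + G i)) = ?H *\<^sub>v ((- 1) \<cdot>\<^sub>v U i)" by simp
  then have *: "S \<cdot>\<^sub>v G j = (- 1) \<cdot>\<^sub>v (?H *\<^sub>v U i)"
    using G(1)[OF i(2)] cc[of i] H by (simp add: mult_mat_vec[of _ n n] ji)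
  have "?H *\<^sub>v U i = S \<cdot>\<^sub>v Y j"
  proof (rule eq_vecI)
    fix k assume "k < dim_vec (S \<cdot>\<^sub>v Y j)"
    then have k: "k < n" using Y[of j] by simp
    have "(S \<cdot>\<^sub>v G j) $ k = ((- 1) \<cdot>\<^sub>v (?H *\<^sub>v U i)) $ k" using * by simp
    then have "S * G j $ k = - ((?H *\<^sub>v U i) $ k)"
      using k cc[of j, THEN carrier_vecD] H by (simp del: index_mult_mat_vec)
    moreover have "S * X j $ k + S * G j $ k = 0"
      using E'[OF j(2) k] Uj k by (simp add: distrib_left)
    ultimately show "(?H *\<^sub>v U i) $ k = (S \<cdot>\<^sub>v Y j) $ k"
      using k cc[of j, THEN carrier_vecD] by (simp add: Yj del: index_mult_mat_vec)
  qed (use H Y[of j] in simp)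
  then have "?H *\<^sub>v (A *\<^sub>v Y j) = of_real (s\<^sup>2) \<cdot>\<^sub>v Y j" by (simp add: UiY S_def)
  then show ?thesis using that Y j(3) by blast
qed

section \<open>The contradiction for three or more blocks\<close>

lemma invertible_mat_mult_vec_eq_0:
  fixes A :: "complex mat"
  assumes A: "A \<in> carrier_mat n n" and inv: "invertible_mat A" and v: "v \<in> carrier_vec n"
    and z: "A *\<^sub>v v = 0\<^sub>v n"
  shows "v = 0\<^sub>v n"
proof -
  obtain B where B: "A * B = 1\<^sub>m (dim_row A)" "B * A = 1\<^sub>m (dim_row B)"
    using inv by (auto simp: invertible_mat_def inverts_mat_def)
  have Bc: "B \<in> carrier_mat n n"
    using arg_cong[OF B(1), of dim_col] arg_cong[OF B(2), of dim_col] A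
    by (intro carrier_matI) simp_all
  have "v = (B * A) *\<^sub>v v" using B(2) Bc v by simp
  also have "\<dots> = B *\<^sub>v (A *\<^sub>v v)" using A Bc v by simp
  also have "\<dots> = 0\<^sub>v n" unfolding z using Bc by simp
  finally show ?thesis .
qed

theorem KMS_matrix_elliptic_arc_imp_eq_2:
  assumes m: "m \<ge> 2" and n: "n \<ge> 1" and A: "A \<in> carrier_mat n n" and inv: "invertible_mat A"
    and arc: "elliptic_arc S" "S \<subseteq> frontier (numerical_range (KMS_matrix m A))"
  shows "m = 2"
proof (rule ccontr)
  assume "m \<noteq> 2"
  then have m3: "m \<ge> 3" using m by simp
  let ?K = "KMS_matrix m A" and ?N = "m * n"
  have K: "?K \<in> carrier_mat ?N ?N" by (rule KMS_matrix_carrier[OF A])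
  have zero: "0 \<in> numerical_range ?K" using zero_mem_numerical_range_KMS_matrix[OF A _ n] m by simp
  obtain r \<alpha> \<beta> where r: "r > 0" and I: "\<alpha> < \<beta>"
    and sup: "\<And>\<theta> w. \<alpha> < \<theta> \<Longrightarrow> \<theta> < \<beta> \<Longrightarrow> w \<in> numerical_range ?K \<Longrightarrow> Re (cis (- \<theta>) * w) \<le> r"
    and ex: "\<exists>x\<in>carrier_vec ?N. x \<noteq> 0\<^sub>v ?N \<and>
       ?K *\<^sub>v x + of_real (4 * r\<^sup>2) \<cdot>\<^sub>v (conj_transpose ?K *\<^sub>v x) = of_real (- 4 * r\<^sup>2) \<cdot>\<^sub>v x"
    using elliptic_arc_frontier_nilpotent[OF K _ zero arc] KMS_matrix_eigenvalue_zero[OF A] by metis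
  define s where "s = 2 * r"
  have s: "s > 0" "4 * r\<^sup>2 = s\<^sup>2" "- 4 * r\<^sup>2 = - s\<^sup>2" using r by (simp_all add: s_def)
  obtain v0 where v0: "v0 \<in> carrier_vec n" "v0 \<noteq> 0\<^sub>v n"
    "conj_transpose A *\<^sub>v (A *\<^sub>v v0) = of_real (s\<^sup>2) \<cdot>\<^sub>v v0"
    using ex[unfolded s(2,3)] KMS_matrix_pencil_singular_value[OF A s(1)] by blast
  define q where "q = Re (v0 \<bullet>c v0)"
  have q: "q > 0" "v0 \<bullet>c v0 = of_real q" using cscalar_prod_self_pos[OF v0(1,2)] by (simp_all add: q_def)
  \<comment> \<open>Scaled so that \<open>v\<close>, and with it \<open>w\<close>, has squared norm
    1/2; the two together then form a unit vector.\<close>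
  define c where "c = complex_of_real (1 / sqrt (2 * q))"
  have c: "c * cnj c = 1 / of_real (2 * q)" "c \<noteq> 0"
    using q(1) by (simp_all add: c_def flip: of_real_mult)
  define v where "v = c \<cdot>\<^sub>v v0"
  have v: "v \<in> carrier_vec n" using v0 by (simp add: v_def)
  have vv: "v \<bullet>c v = 1 / 2"
  proof -
    have "v \<bullet>c v = c * cnj c * (v0 \<bullet>c v0)"
      using v0(1) by (simp add: v_def cscalar_prod_sum[of _ n] sum_distrib_left mult_ac)
    then show ?thesis using q by (simp add: c)
  qed
  have AAv: "conj_transpose A *\<^sub>v (A *\<^sub>v v) = of_real (s\<^sup>2) \<cdot>\<^sub>v v"
  proof -
    have H: "conj_transpose A \<in> carrier_mat n n" "A *\<^sub>v v0 \<in> carrier_vec n" using A v0 by simp_all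
    have "conj_transpose A *\<^sub>v (A *\<^sub>v v) = c \<cdot>\<^sub>v (conj_transpose A *\<^sub>v (A *\<^sub>v v0))"
      unfolding v_def mult_mat_vec[OF A v0(1)] mult_mat_vec[OF H] ..
    then show ?thesis unfolding v0(3) v_def by (simp add: smult_smult_assoc mult.commute)
  qed
  \<comment> \<open>The left singular vector belonging to \<open>v\<close> and the singular value
    \<open>s\<close>.\<close>
  define w where "w = of_real (1 / s) \<cdot>\<^sub>v (A *\<^sub>v v)"
  have w: "w \<in> carrier_vec n" using A v by (simp add: w_def)
  have Av: "A *\<^sub>v v = of_real s \<cdot>\<^sub>v w"
    using s(1) by (simp add: w_def smult_smult_assoc flip: of_real_mult)
  have ww: "w \<bullet>c w = 1 / 2"
  proof -
    have Avc: "A *\<^sub>v v \<in> carrier_vec n" using A v by simp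
    have "w \<bullet>c w = of_real (1 / s) * cnj (of_real (1 / s)) * ((A *\<^sub>v v) \<bullet>c (A *\<^sub>v v))"
      unfolding w_def using Avc A v by (simp add: cscalar_prod_sum[of _ n] sum_distrib_left mult_ac del: index_mult_mat_vec)
    also have "(A *\<^sub>v v) \<bullet>c (A *\<^sub>v v) = of_real (s\<^sup>2) * (v \<bullet>c v)"
      unfolding cscalar_prod_conj_transpose[OF A v Avc] AAv
      using v by (simp add: cscalar_prod_sum[of _ n] sum_distrib_left mult_ac)
    finally show ?thesis unfolding vv using s(1) by (simp add: power2_eq_square)
  qed
  \<comment> \<open>Room to avoid the one value of \<open>cis \<theta>\<close> at which 1 + s e^(i
    theta) vanishes.\<close>
  have "infinite (cis ` {\<alpha><..<\<beta>})" using I by (rule infinite_cis_image)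
  then have "\<not> cis ` {\<alpha><..<\<beta>} \<subseteq> {- 1 / of_real s}" by (meson finite.simps finite_subset)
  then obtain \<theta> where th: "\<alpha> < \<theta>" "\<theta> < \<beta>" "cis \<theta> \<noteq> - 1 / of_real s"
    by (metis greaterThanLessThan_iff image_subsetI insertI1)
  have cc: "cis \<theta> * cnj (cis \<theta>) = 1" "cis (- \<theta>) * cis \<theta> = 1"
    unfolding cis_cnj cis_mult by simp_all
  \<comment> \<open>Indices start at 0, so these are the second and third blocks, and block 0 stays
    empty. The phase on \<open>v\<close> sets the argument of the attained value, which is s e^(i
    theta) |w|^2 = r e^(i theta).\<close>
  define F where "F i = (if i = 1 then w else if i = 2 then cis \<theta> \<cdot>\<^sub>v v else 0\<^sub>v n)" for i :: nat
  define x where "x = block_vec m n F"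
  have x: "x \<in> carrier_vec ?N" by (simp add: x_def)
  have xi: "vec_block n i x = F i" if "i < m" for i
    unfolding x_def using that v w by (intro vec_block_block_vec) (auto simp: F_def)
  define u where "u = ?K *\<^sub>v x"
  have u: "u \<in> carrier_vec ?N"
    using K x by (auto simp: u_def intro!: mult_mat_vec_carrier[of _ ?N ?N])
  note U = vec_block_KMS_matrix[OF A x, folded u_def]
  have u0: "vec_block n i u = 0\<^sub>v n" if "2 \<le> i" "i < m" for i
    using that
  proof (induction "m - i" arbitrary: i)
    case (Suc d)
    show ?case
    proof (cases "Suc i = m")
      case True
      then show ?thesis by (rule U(2))
    next
      case False
      then have i: "Suc i < m" using Suc by simp
      have "vec_block n (Suc i) u = 0\<^sub>v n" using Suc(1)[of "Suc i"] Suc(2,3) i by simp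
      then show ?thesis
        using U(1)[OF i] xi[OF i] Suc(3) A by (simp add: F_def)
    qed
  qed simp
  have u1: "vec_block n 1 u = (of_real s * cis \<theta>) \<cdot>\<^sub>v w"
  proof -
    have "vec_block n 1 u = A *\<^sub>v (cis \<theta> \<cdot>\<^sub>v v + 0\<^sub>v n)"
      using U(1)[of 1] m3 xi[of 2] u0[of 2] by (simp add: F_def numeral_2_eq_2)
    also have "\<dots> = cis \<theta> \<cdot>\<^sub>v (A *\<^sub>v v)" using v by (simp add: mult_mat_vec[OF A])
    finally show ?thesis unfolding Av by (simp add: smult_smult_assoc mult.commute)
  qed
  have sum3: "(\<Sum>i<m. f i) = f 0 + f 1 + f 2" if "\<And>i. 3 \<le> i \<Longrightarrow> i < m \<Longrightarrow> f i = 0" for f :: "nat \<Rightarrow> complex"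
  proof -
    have "(\<Sum>i<m. f i) = (\<Sum>i\<in>{0, 1, 2}. f i)"
      using m3 that by (intro sum.mono_neutral_right) auto
    then show ?thesis by simp
  qed
  have xx: "x \<bullet>c x = 1"
  proof -
    have "x \<bullet>c x = w \<bullet>c w + (cis \<theta> \<cdot>\<^sub>v v) \<bullet>c (cis \<theta> \<cdot>\<^sub>v v)"
      unfolding cscalar_prod_blocks[OF x x] using m3 by (subst sum3) (simp_all add: xi F_def)
    also have "(cis \<theta> \<cdot>\<^sub>v v) \<bullet>c (cis \<theta> \<cdot>\<^sub>v v) = (cis \<theta> * cnj (cis \<theta>)) * (v \<bullet>c v)"
      using v by (simp add: cscalar_prod_sum[of _ n] sum_distrib_left mult_ac)
    finally show ?thesis unfolding cc vv ww by simp
  qed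
  have Kx: "(?K *\<^sub>v x) \<bullet>c x = of_real r * cis \<theta>"
  proof -
    have "u \<bullet>c x = ((of_real s * cis \<theta>) \<cdot>\<^sub>v w) \<bullet>c w"
    proof -
      have "u \<bullet>c x = (\<Sum>i<m. vec_block n i u \<bullet>c F i)"
        unfolding cscalar_prod_blocks[OF u x] by (intro sum.cong refl) (simp add: xi)
      also have "\<dots> = vec_block n 0 u \<bullet>c F 0 + vec_block n 1 u \<bullet>c F 1 + vec_block n 2 u \<bullet>c F 2"
        by (rule sum3) (simp add: F_def scalar_prod_right_zero[OF vec_block_carrier])
      also have "vec_block n 0 u \<bullet>c F 0 = 0" by (simp add: F_def scalar_prod_right_zero[OF vec_block_carrier])
      also have "vec_block n 2 u \<bullet>c F 2 = 0"
      proof -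
        have "conjugate (F 2) \<in> carrier_vec n" using v by (simp add: F_def)
        then show ?thesis using u0[of 2] m3 by simp
      qed
      also have "vec_block n 1 u \<bullet>c F 1 = ((of_real s * cis \<theta>) \<cdot>\<^sub>v w) \<bullet>c w"
        unfolding u1 by (simp add: F_def)
      finally show ?thesis by (simp only: add_0_left add_0_right)
    qed
    also have "\<dots> = of_real s * cis \<theta> * (w \<bullet>c w)"
      using w by (simp add: cscalar_prod_sum[of _ n] sum_distrib_left mult_ac)
    finally show ?thesis unfolding ww by (simp add: s_def u_def)
  qed
  have re: "Re (cnj (cis \<theta>) * ((?K *\<^sub>v x) \<bullet>c x)) = r"
  proof -
    have "cnj (cis \<theta>) * ((?K *\<^sub>v x) \<bullet>c x) = of_real r * (cis (- \<theta>) * cis \<theta>)"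
      unfolding Kx by (simp add: cis_cnj)
    then show ?thesis unfolding cc by simp
  qed
  define g where "g = conj_transpose ?K *\<^sub>v x"
  have g: "g \<in> carrier_vec ?N"
    using K x by (auto simp: g_def intro!: mult_mat_vec_carrier[of _ ?N ?N])
  \<comment> \<open>\<open>x\<close> attains the bound \<open>r\<close> in the direction
    \<open>cis \<theta>\<close>, so it satisfies the kernel equation of that supporting
    line.\<close>
  have "cnj (cis \<theta>) \<cdot>\<^sub>v u + cis \<theta> \<cdot>\<^sub>v g = of_real (2 * r) \<cdot>\<^sub>v x"
    unfolding u_def g_def
  proof (subst re[symmetric], rule supporting_line_imp_kernel[OF K _ x xx])
    fix z assume "z \<in> numerical_range ?K"
    then show "Re (cnj (cis \<theta>) * z) \<le> Re (cnj (cis \<theta>) * ((?K *\<^sub>v x) \<bullet>c x))"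
      unfolding re using sup[OF th(1,2)] by (simp only: cis_cnj)
  qed
  \<comment> \<open>Only block 0 is examined: both the adjoint term and \<open>x\<close> are zero
    there.\<close>
  then have "vec_block n 0 (cnj (cis \<theta>) \<cdot>\<^sub>v u + cis \<theta> \<cdot>\<^sub>v g) = vec_block n 0 (of_real (2 * r) \<cdot>\<^sub>v x)" by simp
  then have "cnj (cis \<theta>) \<cdot>\<^sub>v vec_block n 0 u + cis \<theta> \<cdot>\<^sub>v vec_block n 0 g = of_real (2 * r) \<cdot>\<^sub>v vec_block n 0 x"
    using m3 u g x by (simp add: vec_block_add[of _ m] vec_block_smult[of _ m])
  moreover have "vec_block n 0 g = 0\<^sub>v n"
    using vec_block_conj_transpose_KMS_matrix(2)[OF A x] m3 by (simp add: g_def)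
  moreover have "vec_block n 0 x = 0\<^sub>v n" using xi[of 0] m3 by (simp add: F_def)
  ultimately have z: "cnj (cis \<theta>) \<cdot>\<^sub>v vec_block n 0 u = 0\<^sub>v n"
    by (simp add: right_zero_vec[of _ n])
  have "vec_block n 0 u = A *\<^sub>v (w + (of_real s * cis \<theta>) \<cdot>\<^sub>v w)"
    using U(1)[of 0] m3 xi[of 1] u1 by (simp add: F_def)
  also have "w + (of_real s * cis \<theta>) \<cdot>\<^sub>v w = (1 + of_real s * cis \<theta>) \<cdot>\<^sub>v w"
    using w by (intro eq_vecI) (auto simp: algebra_simps)
  also have "A *\<^sub>v \<dots> = (1 + of_real s * cis \<theta>) \<cdot>\<^sub>v (A *\<^sub>v w)" by (rule mult_mat_vec[OF A w])
  finally have u0': "vec_block n 0 u = (1 + of_real s * cis \<theta>) \<cdot>\<^sub>v (A *\<^sub>v w)" .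
  have nz: "cnj (cis \<theta>) * (1 + of_real s * cis \<theta>) \<noteq> 0"
  proof -
    have "1 + of_real s * cis \<theta> \<noteq> 0"
      using th(3) s(1) by (auto simp: add_eq_0_iff field_simps)
    then show ?thesis by simp
  qed
  have "A *\<^sub>v w = 0\<^sub>v n"
  proof (rule eq_vecI)
    fix k assume k: "k < dim_vec (0\<^sub>v n :: complex vec)"
    have "(cnj (cis \<theta>) \<cdot>\<^sub>v vec_block n 0 u) $ k = 0" unfolding z using k by simp
    then have "cnj (cis \<theta>) * (1 + of_real s * cis \<theta>) * (A *\<^sub>v w) $ k = 0"
      unfolding u0' using k A by (simp del: index_mult_mat_vec)
    then show "(A *\<^sub>v w) $ k = 0\<^sub>v n $ k" using nz k by (simp del: index_mult_mat_vec)
  qed (use A in simp)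
  then have "w = 0\<^sub>v n" by (rule invertible_mat_mult_vec_eq_0[OF A inv w])
  then show False using ww by simp
qed

section \<open>The case of two blocks\<close>

text \<open>Compactness gives a point of maximal modulus, its rotations form the whole bounding
  circle, and every shorter vector lies on a diameter, hence in the set by convexity. The given
  nonzero point keeps the radius positive.\<close>

lemma rotation_invariant_compact_convex_eq_cball:
  fixes S :: "complex set"
  assumes S: "compact S" "convex S" and rot: "\<And>z t. z \<in> S \<Longrightarrow> cis t * z \<in> S"
    and z: "z \<in> S" "z \<noteq> 0"
  obtains r where "r > 0" "S = cball 0 r"
proof -
  obtain p where p: "p \<in> S" "\<And>w. w \<in> S \<Longrightarrow> cmod w \<le> cmod p"
    using continuous_attains_sup[OF S(1), of cmod] z(1) by (auto intro: continuous_intros)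
  define r where "r = cmod p"
  have r: "r > 0" using p(2)[OF z(1)] z(2) by (auto simp: r_def)
  have sphere: "w \<in> S" if "cmod w = r" for w
  proof -
    have p0: "p \<noteq> 0" "w \<noteq> 0" using r that by (auto simp: r_def)
    have "w = cis (Arg w - Arg p) * p"
    proof -
      have "p = of_real r * cis (Arg p)" "w = of_real r * cis (Arg w)"
        using p0 that r cis_Arg[of p] cis_Arg[of w] by (simp_all add: sgn_eq r_def field_simps)
      moreover have "cis (Arg w) = cis (Arg w - Arg p) * cis (Arg p)" by (simp add: cis_mult)
      ultimately show ?thesis by (metis mult.left_commute)
    qed
    then show ?thesis using rot[OF p(1)] by metis
  qed
  have "S = cball 0 r"
  proof
    show "S \<subseteq> cball 0 r" using p(2) by (auto simp: r_def)
    show "cball 0 r \<subseteq> S"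
    proof
      fix w :: complex assume "w \<in> cball 0 r"
      then have w: "cmod w \<le> r" by simp
      \<comment> \<open>For \<open>w = 0\<close> any direction serves; 1 is the default.\<close>
      define d where "d = (if w = 0 then 1 else sgn w)"
      have d: "cmod d = 1" "w = of_real (cmod w) * d"
        by (auto simp: d_def norm_sgn) (simp add: sgn_eq)
      \<comment> \<open>The weight that puts \<open>w\<close> on the diameter through
        \<open>d\<close>: it solves \<open>(2 * c - 1) * r = cmod w\<close>.\<close>
      define c where "c = (1 + cmod w / r) / 2"
      have "of_real r * d \<in> S" "- (of_real r * d) \<in> S"
        using r d by (auto intro!: sphere simp: norm_mult)
      moreover have "0 \<le> c" "c \<le> 1" using w r by (simp_all add: c_def field_simps)
      ultimately have "c *\<^sub>R (of_real r * d) + (1 - c) *\<^sub>R (- (of_real r * d)) \<in> S"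
        by (intro convexD[OF S(2)]) auto
      also have "c *\<^sub>R (of_real r * d) + (1 - c) *\<^sub>R (- (of_real r * d)) = of_real ((2 * c - 1) * r) * d"
        by (simp add: scaleR_conv_of_real algebra_simps)
      also have "(2 * c - 1) * r = cmod w" using r by (simp add: c_def field_simps)
      finally show "w \<in> S" using d(2) by simp
    qed
  qed
  then show ?thesis using r that by blast
qed

text \<open>With two blocks the only nonzero block is \<open>A\<close> in the upper right corner.
  The two parts of the vector are thus coupled only through one sesquilinear term, and rotating
  \<open>q\<close> alone rotates the value without changing the norm.\<close>

lemma KMS_matrix_2_numerical_range_iff:
  assumes A: "A \<in> carrier_mat n n"
  shows "z \<in> numerical_range (KMS_matrix 2 A) \<longleftrightarrow>
    (\<exists>p\<in>carrier_vec n. \<exists>q\<in>carrier_vec n. p \<bullet>c p + q \<bullet>c q = 1 \<and> z = (A *\<^sub>v q) \<bullet>c p)"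
proof -
  have K: "KMS_matrix 2 A \<in> carrier_mat (2 * n) (2 * n)" by (rule KMS_matrix_carrier[OF A])
  have sum2: "(\<Sum>i<2. f i) = f 0 + f 1" for f :: "nat \<Rightarrow> complex" by (simp add: numeral_2_eq_2)
  have xx: "x \<bullet>c x = vec_block n 0 x \<bullet>c vec_block n 0 x + vec_block n 1 x \<bullet>c vec_block n 1 x"
    if x: "x \<in> carrier_vec (2 * n)" for x
    unfolding cscalar_prod_blocks[OF x x] sum2 ..
  have Kx: "(KMS_matrix 2 A *\<^sub>v x) \<bullet>c x = (A *\<^sub>v vec_block n 1 x) \<bullet>c vec_block n 0 x"
    if x: "x \<in> carrier_vec (2 * n)" for x
  proof -
    have u: "KMS_matrix 2 A *\<^sub>v x \<in> carrier_vec (2 * n)"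
      using K x by (auto intro!: mult_mat_vec_carrier[of _ "2 * n" "2 * n"])
    have u1: "vec_block n 1 (KMS_matrix 2 A *\<^sub>v x) = 0\<^sub>v n"
      by (rule vec_block_KMS_matrix(2)[OF A x]) simp
    have "vec_block n 0 (KMS_matrix 2 A *\<^sub>v x) = A *\<^sub>v (vec_block n 1 x + 0\<^sub>v n)"
      using vec_block_KMS_matrix(1)[OF A x, of 0] u1 by simp
    then have u0: "vec_block n 0 (KMS_matrix 2 A *\<^sub>v x) = A *\<^sub>v vec_block n 1 x"
      by (simp add: right_zero_vec[OF vec_block_carrier])
    have "conjugate (vec_block n 1 x) \<in> carrier_vec n" by simp
    then show ?thesis
      unfolding cscalar_prod_blocks[OF u x] sum2 u0 u1 by (simp only: scalar_prod_left_zero add_0_right)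
  qed
  show ?thesis
  proof
    assume "z \<in> numerical_range (KMS_matrix 2 A)"
    then show "\<exists>p\<in>carrier_vec n. \<exists>q\<in>carrier_vec n. p \<bullet>c p + q \<bullet>c q = 1 \<and> z = (A *\<^sub>v q) \<bullet>c p"
      unfolding numerical_range_iff[OF K] using xx Kx vec_block_carrier by metis
  next
    assume "\<exists>p\<in>carrier_vec n. \<exists>q\<in>carrier_vec n. p \<bullet>c p + q \<bullet>c q = 1 \<and> z = (A *\<^sub>v q) \<bullet>c p"
    then obtain p q where pq: "p \<in> carrier_vec n" "q \<in> carrier_vec n"
      "p \<bullet>c p + q \<bullet>c q = 1" "z = (A *\<^sub>v q) \<bullet>c p" by blast
    define x where "x = block_vec 2 n (\<lambda>i. if i = 0 then p else q)"
    have x: "x \<in> carrier_vec (2 * n)" by (simp add: x_def)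
    have "vec_block n 0 x = p" "vec_block n 1 x = q"
      unfolding x_def using pq by (simp_all add: vec_block_block_vec)
    then show "z \<in> numerical_range (KMS_matrix 2 A)"
      unfolding numerical_range_iff[OF K] using xx[OF x] Kx[OF x] x pq by metis
  qed
qed

lemma KMS_matrix_2_numerical_range:
  assumes n: "n \<ge> 1" and A: "A \<in> carrier_mat n n" and inv: "invertible_mat A"
  obtains r where "r > 0" "numerical_range (KMS_matrix 2 A) = cball 0 r"
proof -
  let ?W = "numerical_range (KMS_matrix 2 A)"
  have K: "KMS_matrix 2 A \<in> carrier_mat (2 * n) (2 * n)" by (rule KMS_matrix_carrier[OF A])
  note W = KMS_matrix_2_numerical_range_iff[OF A]
  have rot: "cis t * z \<in> ?W" if z: "z \<in> ?W" for z t
  proof -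
    obtain p q where pq: "p \<in> carrier_vec n" "q \<in> carrier_vec n"
      "p \<bullet>c p + q \<bullet>c q = 1" "z = (A *\<^sub>v q) \<bullet>c p"
      using z unfolding W by blast
    define q' where "q' = cis t \<cdot>\<^sub>v q"
    have q': "q' \<in> carrier_vec n" using pq by (simp add: q'_def)
    have ct: "cis t * cnj (cis t) = 1" unfolding cis_cnj cis_mult by simp
    have "q' \<bullet>c q' = (cis t * cnj (cis t)) * (q \<bullet>c q)"
      using pq(2) by (simp add: q'_def cscalar_prod_sum[of _ n] sum_distrib_left mult_ac)
    then have "p \<bullet>c p + q' \<bullet>c q' = 1" using pq(3) unfolding ct by simp
    moreover have "(A *\<^sub>v q') \<bullet>c p = cis t * z"
      unfolding q'_def mult_mat_vec[OF A pq(2)] pq(4) using pq A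
      by (simp add: cscalar_prod_sum[of _ n] sum_distrib_left mult_ac del: index_mult_mat_vec)
    ultimately show ?thesis unfolding W using pq(1) q' by metis
  qed
  obtain z where z: "z \<in> ?W" "z \<noteq> 0"
  proof -
    define y :: "complex vec" where "y = unit_vec n 0"
    have y: "y \<in> carrier_vec n" "y \<noteq> 0\<^sub>v n"
      using n by (auto simp: y_def vec_eq_iff)
    \<comment> \<open>Choosing the first part as the image of the second gives the value |A y|^2 /
      (|A y|^2 + |y|^2) after normalisation, which is nonzero because \<open>A\<close> is
      nonsingular.\<close>
    define p where "p = A *\<^sub>v y"
    have p: "p \<in> carrier_vec n" "p \<noteq> 0\<^sub>v n"
      using invertible_mat_mult_vec_eq_0[OF A inv y(1)] y A by (auto simp: p_def)
    define a b where "a = Re (p \<bullet>c p)" and "b = Re (y \<bullet>c y)"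
    have a: "a > 0" "p \<bullet>c p = of_real a" using cscalar_prod_self_pos[OF p] by (simp_all add: a_def)
    have b: "b > 0" "y \<bullet>c y = of_real b" using cscalar_prod_self_pos[OF y] by (simp_all add: b_def)
    define c where "c = complex_of_real (1 / sqrt (a + b))"
    have c: "c * cnj c = 1 / of_real (a + b)" using a b by (simp add: c_def flip: of_real_mult of_real_add)
    have sc: "(c \<cdot>\<^sub>v v) \<bullet>c (c \<cdot>\<^sub>v v') = c * cnj c * (v \<bullet>c v')"
      if "v \<in> carrier_vec n" "v' \<in> carrier_vec n" for v v'
      using that by (simp add: cscalar_prod_sum[of _ n] sum_distrib_left mult_ac)
    have ab: "complex_of_real (a + b) \<noteq> 0" using a b by (simp del: of_real_add)
    have "(c \<cdot>\<^sub>v p) \<bullet>c (c \<cdot>\<^sub>v p) + (c \<cdot>\<^sub>v y) \<bullet>c (c \<cdot>\<^sub>v y) = of_real (a + b) / of_real (a + b)"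
      unfolding sc[OF p(1) p(1)] sc[OF y(1) y(1)] c a(2) b(2)
      by (simp only: distrib_left[symmetric] of_real_add[symmetric] add_divide_distrib[symmetric] times_divide_eq_left mult_1_left)
    also have "\<dots> = 1" using ab by (rule divide_self)
    finally have "(A *\<^sub>v (c \<cdot>\<^sub>v y)) \<bullet>c (c \<cdot>\<^sub>v p) \<in> ?W"
      unfolding W using p(1) y(1) by (metis smult_carrier_vec)
    moreover have "(A *\<^sub>v (c \<cdot>\<^sub>v y)) \<bullet>c (c \<cdot>\<^sub>v p) = of_real a / of_real (a + b)"
      unfolding mult_mat_vec[OF A y(1)] p_def[symmetric] sc[OF p(1) p(1)] c a(2) by simp
    moreover have "complex_of_real a / of_real (a + b) \<noteq> 0" using a ab by simp
    ultimately show ?thesis using that by metis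
  qed
  show ?thesis
    using rotation_invariant_compact_convex_eq_cball[OF compact_numerical_range[OF K]
        convex_numerical_range[OF K] rot z] that by blast
qed

section \<open>Circles carry elliptic arcs, and the equivalence\<close>

lemma elliptic_arc_in_circle:
  assumes r: "r > 0"
  shows "\<exists>S. elliptic_arc S \<and> S \<subseteq> frontier (cball (0 :: complex) r)"
proof -
  have "cball (0 :: complex) r = {0 + cis 0 * Complex (r * u) (r * v) | u v. u\<^sup>2 + v\<^sup>2 \<le> 1}"
  proof (intro equalityI subsetI)
    fix z :: complex assume "z \<in> cball 0 r"
    then have "(cmod z)\<^sup>2 \<le> r\<^sup>2" by (simp add: power_mono)
    then have "(Re z / r)\<^sup>2 + (Im z / r)\<^sup>2 \<le> 1"
      using r by (simp add: cmod_power2 power_divide flip: add_divide_distrib)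
    moreover have "z = 0 + cis 0 * Complex (r * (Re z / r)) (r * (Im z / r))"
      using r by (simp add: complex_eq_iff)
    ultimately show "z \<in> {0 + cis 0 * Complex (r * u) (r * v) | u v. u\<^sup>2 + v\<^sup>2 \<le> 1}" by blast
  next
    fix z assume "z \<in> {0 + cis 0 * Complex (r * u) (r * v) | u v. u\<^sup>2 + v\<^sup>2 \<le> 1}"
    then obtain u v where uv: "u\<^sup>2 + v\<^sup>2 \<le> 1" "z = Complex (r * u) (r * v)" by auto
    have "(cmod z)\<^sup>2 = r\<^sup>2 * (u\<^sup>2 + v\<^sup>2)"
      unfolding uv(2) cmod_power2 by (simp add: power_mult_distrib distrib_left)
    also have "\<dots> \<le> r\<^sup>2 * 1" using uv(1) by (intro mult_left_mono) auto
    finally have "cmod z \<le> r" using r power2_le_imp_le[of "cmod z" r] by simp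
    then show "z \<in> cball 0 r" by simp
  qed
  then have E: "elliptic_disk (cball 0 r)"
    unfolding elliptic_disk_def using r by blast
  \<comment> \<open>One radian of the circle: the angles stay below pi, so the cosine already
    separates the points.\<close>
  define g where "g s = of_real r * cis s" for s :: real
  have "inj_on g {0..1}"
  proof (rule inj_onI)
    fix u v :: real assume uv: "u \<in> {0..1}" "v \<in> {0..1}" "g u = g v"
    then have "cos u = cos v" using r by (auto simp: g_def complex_eq_iff)
    then show "u = v" using uv cos_inj_pi[of u v] pi_gt3 by auto
  qed
  moreover have "path g" unfolding path_def g_def by (intro continuous_intros)
  ultimately have "arc g" by (simp add: arc_def)
  moreover have "path_image g \<subseteq> frontier (cball 0 r)"
    using r by (auto simp: path_image_def g_def norm_mult)
  ultimately show ?thesis using E unfolding elliptic_arc_def by blast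
qed

theorem theorem4p19:
  fixes m n :: nat and A :: "complex mat"
  assumes "m \<ge> 2" and "n \<ge> 1"
    and "A \<in> carrier_mat n n" and "invertible_mat A"
  shows "((\<exists>r>0. numerical_range (KMS_matrix m A) = cball 0 r) \<longleftrightarrow>
          (\<exists>S. elliptic_arc S \<and> S \<subseteq> frontier (numerical_range (KMS_matrix m A)))) \<and>
         ((\<exists>S. elliptic_arc S \<and> S \<subseteq> frontier (numerical_range (KMS_matrix m A))) \<longleftrightarrow> m = 2)"
proof -
  have 12: "\<exists>S. elliptic_arc S \<and> S \<subseteq> frontier (numerical_range (KMS_matrix m A))"
    if "r > 0" "numerical_range (KMS_matrix m A) = cball 0 r" for r
    using elliptic_arc_in_circle[OF that(1)] that(2) by metis
  have 23: "m = 2" if "elliptic_arc S" "S \<subseteq> frontier (numerical_range (KMS_matrix m A))" for S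
    by (rule KMS_matrix_elliptic_arc_imp_eq_2[OF assms that])
  have 31: "\<exists>r>0. numerical_range (KMS_matrix m A) = cball 0 r" if "m = 2"
    unfolding that by (rule KMS_matrix_2_numerical_range[OF assms(2-4)]) blast
  show ?thesis using 12 23 31 by metis
qed

end
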